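(* Let $A$ be an $m\times n$ matrix, $b\in\mathbb{R}^m$, $\mu>0$, and consider the Lasso problem of minimizing $$\varphi(x):=\tfrac12\|Ax-b\|_2^2+\mu\|x\|_1,\quad x\in\mathbb{R}^n.$$ Put $g(x):=\mu\|x\|_1$. Let $\bar x$ be an optimal solution of this problem such that $\partial\varphi$ is metrically regular around $(\bar x,0)$. Then: (1) $g$ is prox-bounded on $\mathbb{R}^n$ and continuously prox-regular at $\bar x$ for $-A^*A\bar x+A^*b$; there is a neighborhood $U'\times V'$ of $(\bar x,0)$ such that for every $(x,v)\in\mathrm{gph}\,\partial\varphi\cap(U'\times V')$ there exists $d\in\mathbb{R}^n$ with $-v\in\partial^2\varphi(x,v)(d)$; and $\partial\varphi$ is semismooth$^*$ at $(\bar x,0)$. (2) For any $\gamma>0$ such that $I-\gamma A^*A$ is nonsingular, the following algorithm is well-defined for all starting points $x^0$ in some neighborhood of $\bar x$, and the sequence of its iterates $\{x^k\}$ locally $Q$-superlinearly converges to $\bar x$. For $k=0,1,\ldots$: if $0\in\partial\varphi(x^k)$, stop; otherwise compute $u^k:=x^k-\gamma(A^*Ax^k-A^*b)$ and $v^k:=\mathrm{Prox}_{\gamma g}(u^k)$, choose $d^k\in\mathbb{R}^n$ such that $$-\tfrac1\gamma(x^k-v^k)-A^*Ad^k\in\partial^2g\Big(v^k,\tfrac1\gamma(u^k-v^k)\Big)(x^k-v^k+d^k),$$ and set $x^{k+1}:=x^k+d^k$. (3) $\bar x$ is a tilt-stable local minimizer of $\varphi$.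
   Context: For $\Omega\subset\mathbb{R}^s$ and $\bar z\in\Omega$: $\widehat N_\Omega(\bar z)=\{v:\limsup_{z\to\bar z,\,z\in\Omega}\frac{\langle v,z-\bar z\rangle}{\|z-\bar z\|}\le 0\}$; $N_\Omega(\bar z)=\{v:\exists\, z_k\to\bar z,\ z_k\in\Omega,\ v_k\to v,\ v_k\in\widehat N_\Omega(z_k)\}$; and for $d\in\mathbb{R}^s$, $N_\Omega(\bar z;d)=\{v:\exists\,t_k\downarrow0,\ d_k\to d,\ v_k\to v,\ v_k\in\widehat N_\Omega(\bar z+t_kd_k)\}$. For $F\colon\mathbb{R}^n\rightrightarrows\mathbb{R}^m$ and $(x,y)\in\mathrm{gph}\,F$, the limiting coderivative is $D^*F(x,y)(v)=\{u:(u,-v)\in N_{\mathrm{gph}\,F}(x,y)\}$, and the directional limiting coderivative in the direction $(u,v)$ is $D^*F((x,y);(u,v))(v^* )=\{u^*:(u^*,-v^* )\in N_{\mathrm{gph}\,F}((x,y);(u,v))\}$. $A^*$ is the transpose of $A$; $\|\cdot\|_2$ and $\|\cdot\|_1$ are the Euclidean and sum norms. For $\psi\colon\mathbb{R}^n\to(-\infty,\infty]$ the limiting subdifferential at $x\in\mathrm{dom}\,\psi$ is $\partial\psi(x)=\{v:(v,-1)\in N_{\mathrm{epi}\,\psi}(x,\psi(x))\}$ (the usual convex subdifferential if $\psi$ is convex), and $\partial^2\psi(x,v)(u)=(D^*\partial\psi)(x,v)(u)$ for $v\in\partial\psi(x)$. $\psi$ is prox-regular at $\bar x\in\mathrm{dom}\,\psi$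 for $\bar v\in\partial\psi(\bar x)$ if it is lower semicontinuous around $\bar x$ and there are $r,\epsilon>0$ such that for all $x,u\in\mathbb{B}_\epsilon(\bar x)$ with $|\psi(u)-\psi(\bar x)|<\epsilon$ one has $\psi(x)\ge\psi(u)+\langle v,x-u\rangle-\frac r2\|x-u\|^2$ whenever $v\in\partial\psi(u)\cap\mathbb{B}_\epsilon(\bar v)$. It is subdifferentially continuous at $\bar x$ for $\bar v$ if $(x_k,v_k)\to(\bar x,\bar v)$ with $v_k\in\partial\psi(x_k)$ implies $\psi(x_k)\to\psi(\bar x)$. Continuously prox-regular means both. Prox-bounded means bounded from below by a quadratic function. $\mathrm{Prox}_{\gamma g}(x)=\mathrm{argmin}_{y}\{g(y)+\frac1{2\gamma}\|y-x\|^2\}$. $F$ is metrically regular around $(\bar x,\bar y)\in\mathrm{gph}\,F$ if there are $\kappa>0$ and neighborhoods $U$ of $\bar x$, $V$ of $\bar y$ with $\mathrm{dist}(x;F^{-1}(y))\le\kappa\,\mathrm{dist}(y;F(x))$ for all $(x,y)\in U\times V$. $F$ is semismooth$^*$ at $(\bar x,\bar y)\in\mathrm{gph}\,F$ if for every $(u,v)$ one has $\langle u^*,u\rangle=\langle v^*,v\rangle$ for all $(v^*,u^* )\in\mathrm{gph}\,D^*F((\bar x,\bar y);(u,v))$. $\bar x$ is a tilt-stable local minimizer of $\varphi$ if for some $\eta>0$ the mapping $v\mapsto\mathrm{argmin}\{\varphi(x)-\langle v,x\rangle:x\in\mathbb{B}_\eta(\bar x)\}$ is single-valued and Lipschitz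 continuous on a neighborhood of $0$ with value $\{\bar x\}$ at $0$. "Well-defined" means that at each non-terminal iterate a suitable $d^k$ (which may be chosen arbitrarily) exists. $Q$-superlinear convergence means $x^k\to\bar x$ and $\|x^{k+1}-\bar x\|/\|x^k-\bar x\|\to0$; if the algorithm stops at some $x^k$, it is understood as $x^k=\bar x$. Explicit data used by the algorithm: $(\mathrm{Prox}_{\gamma g}(x))_i$ equals $x_i-\mu\gamma$ if $x_i>\mu\gamma$, $0$ if $|x_i|\le\mu\gamma$, $x_i+\mu\gamma$ if $x_i<-\mu\gamma$; $\partial\varphi(x)=A^*(Ax-b)+\mu F(x)$ with $F(x)=\{v:v_j=\mathrm{sgn}(x_j)\text{ if }x_j\ne0,\ v_j\in[-1,1]\text{ if }x_j=0\}$; and $\partial^2g(x,y)(v)=\{w:(\frac1\mu w_i,-v_i)\in G(x_i,\frac1\mu y_i),\ i=1,\dots,n\}$, where $G(t,p)$ is $\{0\}\times\mathbb{R}$ if $t\ne0$, $p\in\{-1,1\}$; $\mathbb{R}\times\{0\}$ if $t=0$, $p\in(-1,1)$; $(\mathbb{R}_+\times\mathbb{R}_-)\cup(\{0\}\times\mathbb{R})\cup(\mathbb{R}\times\{0\})$ if $t=0$, $p=-1$; $(\mathbb{R}_-\times\mathbb{R}_+)\cup(\{0\}\times\mathbb{R})\cup(\mathbb{R}\times\{0\})$ if $t=0$, $p=1$; $\emptyset$ otherwise. *)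

theory Defs
  imports "HOL-Analysis.Analysis"
begin

section \<open>Normal cones\<close>

text \<open>Points outside the set have empty normal cones. The filter \<^term>\<open>at z within \<Omega>\<close> excludes
  \<^term>\<open>z\<close> itself; at an isolated point the upper limit is \<^term>\<open>-\<infinity>\<close>, so the cone is everything.\<close>

definition regular_normal_cone :: "'a::euclidean_space set \<Rightarrow> 'a \<Rightarrow> 'a set" where
  "regular_normal_cone \<Omega> z =
    {v. z \<in> \<Omega> \<and> Limsup (at z within \<Omega>) (\<lambda>y. ereal ((v \<bullet> (y - z)) / norm (y - z))) \<le> 0}"

definition limiting_normal_cone :: "'a::euclidean_space set \<Rightarrow> 'a \<Rightarrow> 'a set" where
  "limiting_normal_cone \<Omega> z =
    {v. z \<in> \<Omega> \<and> (\<exists>zs vs. zs \<longlonglongrightarrow> z \<and> vs \<longlonglongrightarrow> v \<and>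
          (\<forall>k. zs k \<in> \<Omega> \<and> vs k \<in> regular_normal_cone \<Omega> (zs k)))}"

definition dir_normal_cone :: "'a::euclidean_space set \<Rightarrow> 'a \<Rightarrow> 'a \<Rightarrow> 'a set" where
  "dir_normal_cone \<Omega> z d =
    {v. z \<in> \<Omega> \<and> (\<exists>(ts :: nat \<Rightarrow> real) ds vs.
          (\<forall>k. ts k > 0) \<and> ts \<longlonglongrightarrow> 0 \<and> ds \<longlonglongrightarrow> d \<and> vs \<longlonglongrightarrow> v \<and>
          (\<forall>k. vs k \<in> regular_normal_cone \<Omega> (z + ts k *\<^sub>R ds k)))}"


section \<open>Set-valued mappings\<close>

definition gph :: "('a \<Rightarrow> 'b set) \<Rightarrow> ('a \<times> 'b) set" where
  "gph F = {(x, y). y \<in> F x}"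

definition coderivative ::
    "('a::euclidean_space \<Rightarrow> 'b::euclidean_space set) \<Rightarrow> 'a \<times> 'b \<Rightarrow> 'b \<Rightarrow> 'a set" where
  "coderivative F p v = {u. (u, - v) \<in> limiting_normal_cone (gph F) p}"

definition dir_coderivative ::
    "('a::euclidean_space \<Rightarrow> 'b::euclidean_space set) \<Rightarrow> 'a \<times> 'b \<Rightarrow> 'a \<times> 'b \<Rightarrow> 'b \<Rightarrow> 'a set" where
  "dir_coderivative F p w v = {u. (u, - v) \<in> dir_normal_cone (gph F) p w}"

text \<open>Unlike \<^const>\<open>infdist\<close>, which is \<open>0\<close> for the empty set, this distance is \<open>\<infinity>\<close> there.\<close>

definition edist_set :: "'a::metric_space \<Rightarrow> 'a set \<Rightarrow> ereal" where
  "edist_set x S = (INF s\<in>S. ereal (dist x s))"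

definition metrically_regular_around ::
    "('a::metric_space \<Rightarrow> 'b::metric_space set) \<Rightarrow> 'a \<times> 'b \<Rightarrow> bool" where
  "metrically_regular_around F p \<longleftrightarrow> p \<in> gph F \<and>
    (\<exists>\<kappa>>0. \<exists>U V. open U \<and> fst p \<in> U \<and> open V \<and> snd p \<in> V \<and>
      (\<forall>x\<in>U. \<forall>y\<in>V. edist_set x {x'. y \<in> F x'} \<le> ereal \<kappa> * edist_set y (F x)))"

definition semismooth_star_at ::
    "('a::euclidean_space \<Rightarrow> 'b::euclidean_space set) \<Rightarrow> 'a \<times> 'b \<Rightarrow> bool" where
  "semismooth_star_at F p \<longleftrightarrow> p \<in> gph F \<and>
    (\<forall>u v. \<forall>(vs, us) \<in> gph (dir_coderivative F p (u, v)). us \<bullet> u = vs \<bullet> v)"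


section \<open>Extended-real-valued functions\<close>

text \<open>Functions into \<open>(-\<infinity>, \<infinity>]\<close> are rendered with values in \<^typ>\<open>ereal\<close>.\<close>

definition epi :: "('a \<Rightarrow> ereal) \<Rightarrow> ('a \<times> real) set" where
  "epi \<psi> = {(x, r). \<psi> x \<le> ereal r}"

definition subdiff :: "('a::euclidean_space \<Rightarrow> ereal) \<Rightarrow> 'a \<Rightarrow> 'a set" where
  "subdiff \<psi> x =
    {v. \<bar>\<psi> x\<bar> \<noteq> \<infinity> \<and> (v, - 1) \<in> limiting_normal_cone (epi \<psi>) (x, real_of_ereal (\<psi> x))}"

definition subdiff2 :: "('a::euclidean_space \<Rightarrow> ereal) \<Rightarrow> 'a \<Rightarrow> 'a \<Rightarrow> 'a \<Rightarrow> 'a set" where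
  "subdiff2 \<psi> x v = coderivative (subdiff \<psi>) (x, v)"

definition lsc_around :: "('a::metric_space \<Rightarrow> ereal) \<Rightarrow> 'a \<Rightarrow> bool" where
  "lsc_around \<psi> x \<longleftrightarrow> (\<exists>\<delta>>0. \<forall>u\<in>ball x \<delta>. \<psi> u \<le> Liminf (at u) \<psi>)"

definition prox_regular :: "('a::euclidean_space \<Rightarrow> ereal) \<Rightarrow> 'a \<Rightarrow> 'a \<Rightarrow> bool" where
  "prox_regular \<psi> xb vb \<longleftrightarrow>
    \<bar>\<psi> xb\<bar> \<noteq> \<infinity> \<and> vb \<in> subdiff \<psi> xb \<and> lsc_around \<psi> xb \<and>
    (\<exists>r>0. \<exists>\<epsilon>>0. \<forall>x\<in>cball xb \<epsilon>. \<forall>u\<in>cball xb \<epsilon>. \<bar>\<psi> u - \<psi> xb\<bar> < ereal \<epsilon> \<longrightarrow>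
      (\<forall>v \<in> subdiff \<psi> u \<inter> cball vb \<epsilon>.
        \<psi> x \<ge> \<psi> u + ereal (v \<bullet> (x - u) - r / 2 * (norm (x - u))\<^sup>2)))"

definition subdiff_continuous :: "('a::euclidean_space \<Rightarrow> ereal) \<Rightarrow> 'a \<Rightarrow> 'a \<Rightarrow> bool" where
  "subdiff_continuous \<psi> xb vb \<longleftrightarrow> vb \<in> subdiff \<psi> xb \<and>
    (\<forall>xs vs. xs \<longlonglongrightarrow> xb \<and> vs \<longlonglongrightarrow> vb \<and> (\<forall>k. vs k \<in> subdiff \<psi> (xs k)) \<longrightarrow>
      (\<lambda>k. \<psi> (xs k)) \<longlonglongrightarrow> \<psi> xb)"

definition continuously_prox_regular :: "('a::euclidean_space \<Rightarrow> ereal) \<Rightarrow> 'a \<Rightarrow> 'a \<Rightarrow> bool" where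
  "continuously_prox_regular \<psi> xb vb \<longleftrightarrow> prox_regular \<psi> xb vb \<and> subdiff_continuous \<psi> xb vb"

definition prox_bounded :: "('a::euclidean_space \<Rightarrow> ereal) \<Rightarrow> bool" where
  "prox_bounded \<psi> \<longleftrightarrow>
    (\<exists>(Q :: 'a \<Rightarrow> 'a) c \<beta>. linear Q \<and> (\<forall>x. \<psi> x \<ge> ereal (x \<bullet> Q x / 2 + c \<bullet> x + \<beta>)))"

definition argmin_set :: "('a \<Rightarrow> 'b::ord) \<Rightarrow> 'a set \<Rightarrow> 'a set" where
  "argmin_set f S = {x. is_arg_min f (\<lambda>y. y \<in> S) x}"

definition prox :: "real \<Rightarrow> ('a::euclidean_space \<Rightarrow> ereal) \<Rightarrow> 'a \<Rightarrow> 'a set" where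
  "prox \<gamma> g x = argmin_set (\<lambda>y. g y + ereal (1 / (2 * \<gamma>) * (norm (y - x))\<^sup>2)) UNIV"

definition tilt_stable_local_minimizer :: "('a::euclidean_space \<Rightarrow> ereal) \<Rightarrow> 'a \<Rightarrow> bool" where
  "tilt_stable_local_minimizer \<phi> xb \<longleftrightarrow> \<bar>\<phi> xb\<bar> \<noteq> \<infinity> \<and>
    (\<exists>\<eta>>0. \<exists>V h L. open V \<and> 0 \<in> V \<and> L-lipschitz_on V h \<and> h 0 = xb \<and>
      (\<forall>v\<in>V. argmin_set (\<lambda>x. \<phi> x - ereal (v \<bullet> x)) (cball xb \<eta>) = {h v}))"


section \<open>The Lasso problem and the algorithm\<close>

definition l1_norm :: "real ^ 'n \<Rightarrow> real" where
  "l1_norm x = (\<Sum>i\<in>UNIV. \<bar>x $ i\<bar>)"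

definition lasso_reg :: "real \<Rightarrow> real ^ 'n \<Rightarrow> ereal" where
  "lasso_reg \<mu> x = ereal (\<mu> * l1_norm x)"

definition lasso :: "real ^ 'n ^ 'm \<Rightarrow> real ^ 'm \<Rightarrow> real \<Rightarrow> real ^ 'n \<Rightarrow> ereal" where
  "lasso A b \<mu> x = ereal (1 / 2 * (norm (A *v x - b))\<^sup>2 + \<mu> * l1_norm x)"

text \<open>The admissible choices \<open>d\<close> at the iterate \<open>x\<close>. Requiring the proximal set to be the
  singleton \<open>{v}\<close> makes the assignment \<open>v := Prox(u)\<close> meaningful, so that existence of an
  admissible \<open>d\<close> covers well-definedness of \<open>v\<close> too.\<close>

definition newton_direction ::
    "real ^ 'n ^ 'm \<Rightarrow> real ^ 'm \<Rightarrow> real \<Rightarrow> real \<Rightarrow> real ^ 'n \<Rightarrow> real ^ 'n \<Rightarrow> bool" where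
  "newton_direction A b \<mu> \<gamma> x d \<longleftrightarrow>
    (\<exists>u v. u = x - \<gamma> *\<^sub>R ((transpose A ** A) *v x - transpose A *v b) \<and>
       prox \<gamma> (lasso_reg \<mu>) u = {v} \<and>
       - ((1 / \<gamma>) *\<^sub>R (x - v)) - (transpose A ** A) *v d
         \<in> subdiff2 (lasso_reg \<mu>) v ((1 / \<gamma>) *\<^sub>R (u - v)) (x - v + d))"

definition terminal :: "real ^ 'n ^ 'm \<Rightarrow> real ^ 'm \<Rightarrow> real \<Rightarrow> real ^ 'n \<Rightarrow> bool" where
  "terminal A b \<mu> x \<longleftrightarrow> 0 \<in> subdiff (lasso A b \<mu>) x"

definition newton_step ::
    "real ^ 'n ^ 'm \<Rightarrow> real ^ 'm \<Rightarrow> real \<Rightarrow> real \<Rightarrow> real ^ 'n \<Rightarrow> real ^ 'n \<Rightarrow> bool" where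
  "newton_step A b \<mu> \<gamma> x x' \<longleftrightarrow>
    \<not> terminal A b \<mu> x \<and> (\<exists>d. newton_direction A b \<mu> \<gamma> x d \<and> x' = x + d)"

text \<open>The choice of \<open>d\<close> is nondeterministic, so \<^term>\<open>(newton_step A b \<mu> \<gamma>)\<^sup>*\<^sup>* x0 x\<close> says that \<open>x\<close> is an
  iterate of some run started at \<open>x0\<close>.\<close>

definition well_defined_from ::
    "real ^ 'n ^ 'm \<Rightarrow> real ^ 'm \<Rightarrow> real \<Rightarrow> real \<Rightarrow> real ^ 'n \<Rightarrow> bool" where
  "well_defined_from A b \<mu> \<gamma> x0 \<longleftrightarrow>
    (\<forall>x. (newton_step A b \<mu> \<gamma>)\<^sup>*\<^sup>* x0 x \<and> \<not> terminal A b \<mu> x \<longrightarrow>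
      (\<exists>d. newton_direction A b \<mu> \<gamma> x d))"

definition q_superlinear :: "(nat \<Rightarrow> 'a::real_normed_vector) \<Rightarrow> 'a \<Rightarrow> bool" where
  "q_superlinear xs xb \<longleftrightarrow>
    xs \<longlonglongrightarrow> xb \<and> (\<lambda>k. norm (xs (Suc k) - xb) / norm (xs k - xb)) \<longlonglongrightarrow> 0"

text \<open>Every run, whatever the choices: if it stops, it stops at the solution; if it does not stop,
  it converges superlinearly.\<close>

definition superlinearly_convergent_from ::
    "real ^ 'n ^ 'm \<Rightarrow> real ^ 'm \<Rightarrow> real \<Rightarrow> real \<Rightarrow> real ^ 'n \<Rightarrow> real ^ 'n \<Rightarrow> bool" where
  "superlinearly_convergent_from A b \<mu> \<gamma> xb x0 \<longleftrightarrow>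
    (\<forall>x. (newton_step A b \<mu> \<gamma>)\<^sup>*\<^sup>* x0 x \<and> terminal A b \<mu> x \<longrightarrow> x = xb) \<and>
    (\<forall>xs. xs 0 = x0 \<and> (\<forall>k. newton_step A b \<mu> \<gamma> (xs k) (xs (Suc k))) \<longrightarrow> q_superlinear xs xb)"

end

theory Submission
  imports Defs
begin

text \<open>Write \<open>q(x) = A\<^sup>T(Ax - b)\<close> for the gradient of the quadratic part, \<open>p = - q(xbar)\<close> for the
  subgradient of \<open>\<mu>\<parallel>\<cdot>\<parallel>\<^sub>1\<close> that certifies optimality of \<open>xbar\<close>, and \<open>J = {i. \<bar>p\<^sub>i\<bar> = \<mu>}\<close> for the active
  coordinates. Everything rests on one consequence of metric regularity, which is the content of
  the locale \<open>nondegenerate_lasso\<close>: \<open>A\<close> is injective on the vectors supported in \<open>J\<close>. It is obtained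
  in \<open>nondegenerate_if_metrically_regular\<close> by moving from \<open>xbar\<close> a little along \<open>sgn p\<close> on \<open>J\<close>. At the
  new point every active coordinate is nonzero, so nearby the graph of the subdifferential is affine
  on \<open>J\<close>, and a residual moved along a kernel vector of \<open>A\<close> supported in \<open>J\<close> has no nearby preimage.

  Near \<open>p\<close> the active set in turn controls all subgradients: a subgradient \<open>y\<close> of \<open>\<mu>\<parallel>\<cdot>\<parallel>\<^sub>1\<close> near \<open>p\<close> can satisfy
  \<open>\<bar>y\<^sub>i\<bar> = \<mu>\<close> only for \<open>i \<in> J\<close>, and then \<open>y\<^sub>i = p\<^sub>i\<close> exactly (\<open>active_near\<close>). The other ingredient is
  a description of normals to the graph of the subdifferential. The graph is the image of
  a product of planar broken lines under the shear \<open>(x, y) \<mapsto> (x, q(x) + y)\<close>; hence a normal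
  \<open>(a, c)\<close> corresponds to the pair \<open>(z, c)\<close> with \<open>z = a + A\<^sup>TAc\<close>, whose coordinates are normals to a
  broken line (\<open>limiting_normal_lasso\<close>, with a partial converse \<open>limiting_normal_lassoI\<close>). The
  subdifferential of \<open>\<mu>\<parallel>\<cdot>\<parallel>\<^sub>1\<close> itself is the case \<open>A = 0\<close>, \<open>b = 0\<close>.

  The parts of the theorem follow.
  For the second-order inclusions, both in the neighborhood statement and in the Newton step, one
  may prescribe \<open>z\<close> to vanish on the support of the point and \<open>c\<close> to vanish off it; as the support is
  contained in \<open>J\<close>, this is a uniquely solvable linear system (\<open>solvable_on_active\<close>).
  Semismoothness holds because the broken lines agree with their tangent rays near \<open>(xbar, p)\<close>.
  For the algorithm more is true than superlinear convergence: each admissible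
  step from a point near \<open>xbar\<close> ends exactly in \<open>xbar\<close> (\<open>newton_step_exact\<close>). For the error \<open>\<xi>\<close> after
  the step satisfies \<open>(A\<^sup>TA\<xi>)\<^sub>i \<xi>\<^sub>i \<le> 0\<close> in every coordinate and is supported in \<open>J\<close>,
  so \<open>A\<xi> = 0\<close> and \<open>\<xi> = 0\<close>. A run therefore stops at \<open>xbar\<close>, and no infinite run exists.
  Tilt stability is strong monotonicity of the subdifferential along \<open>J\<close>.\<close>

text \<open>Products with \<open>A\<^sup>T\<close> stay in the form in which \<open>inner_transpose_mult\<close> moves them across an inner
  product.\<close>

declare transpose_matrix_vector [simp del]

section \<open>Regular and limiting normals\<close>

lemma regular_normal_coneI:
  assumes "z \<in> \<Omega>" and "\<forall>\<^sub>F y in nhds z. y \<in> \<Omega> \<longrightarrow> v \<bullet> (y - z) \<le> 0"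
  shows "v \<in> regular_normal_cone \<Omega> z"
proof -
  have "\<forall>\<^sub>F y in at z within \<Omega>. ereal ((v \<bullet> (y - z)) / norm (y - z)) \<le> 0"
    using assms(2) unfolding eventually_at_filter
    by eventually_elim (auto simp: divide_nonpos_nonneg)
  then show ?thesis
    using assms(1) by (auto simp: regular_normal_cone_def intro: Limsup_bounded)
qed

text \<open>Along a feasible ray the quotient in the upper limit is the constant \<open>v \<bullet> h / \<parallel>h\<parallel>\<close>. All necessary
  conditions on normals below are obtained by testing with such rays.\<close>

lemma regular_normal_cone_feasible_direction:
  assumes v: "v \<in> regular_normal_cone \<Omega> z"
    and feasible: "\<forall>\<^sub>F t in at_right 0. z + t *\<^sub>R h \<in> \<Omega>"
  shows "v \<bullet> h \<le> 0"
proof (cases "h = 0")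
  case False
  have lim: "filterlim (\<lambda>t. z + t *\<^sub>R h) (at z within \<Omega>) (at_right 0)"
  proof -
    have "((\<lambda>t. z + t *\<^sub>R h) \<longlongrightarrow> z + 0 *\<^sub>R h) (at_right 0)"
      by (intro tendsto_intros)
    moreover have "\<forall>\<^sub>F t in at_right (0::real). z + t *\<^sub>R h \<noteq> z"
      using False eventually_at_right_less[of "0::real"] by (auto elim: eventually_mono)
    ultimately show ?thesis
      using feasible by (auto simp: filterlim_at elim: eventually_elim2)
  qed
  have "v \<bullet> h / norm h \<le> e" if "e > 0" for e
  proof -
    have "Limsup (at z within \<Omega>) (\<lambda>y. ereal ((v \<bullet> (y - z)) / norm (y - z))) < ereal e"
      using v that by (auto simp: regular_normal_cone_def zero_ereal_def intro: order.strict_trans1)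
    from filterlim_iff[THEN iffD1, OF lim, rule_format, OF Limsup_lessD[OF this]]
    have "\<forall>\<^sub>F t in at_right 0. (v \<bullet> (z + t *\<^sub>R h - z)) / norm (z + t *\<^sub>R h - z) < e"
      by simp
    then have "\<forall>\<^sub>F t in at_right (0::real). v \<bullet> h / norm h < e"
      using eventually_at_right_less[of "0::real"] by eventually_elim simp
    then show ?thesis
      by simp
  qed
  then have "v \<bullet> h / norm h \<le> 0"
    using field_le_epsilon[of "v \<bullet> h / norm h" 0] by auto
  then show ?thesis
    using False by (simp add: divide_le_0_iff)
qed auto

lemma regular_normal_cone_subset_limiting:
  "regular_normal_cone \<Omega> z \<subseteq> limiting_normal_cone \<Omega> z"
proof
  fix v assume v: "v \<in> regular_normal_cone \<Omega> z"
  then have "z \<in> \<Omega>"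
    by (simp add: regular_normal_cone_def)
  with v have "(\<lambda>_. z) \<longlonglongrightarrow> z \<and> (\<lambda>_. v) \<longlonglongrightarrow> v \<and> (\<forall>k::nat. z \<in> \<Omega> \<and> v \<in> regular_normal_cone \<Omega> z)"
    by simp
  with \<open>z \<in> \<Omega>\<close> show "v \<in> limiting_normal_cone \<Omega> z"
    unfolding limiting_normal_cone_def by blast
qed


section \<open>The subdifferential of a convex function\<close>

text \<open>For regular normals this is the test with segments inside the set; the inequality is stable
  under limits of base points and normals.\<close>

lemma limiting_normal_cone_convex:
  assumes "convex \<Omega>" and "v \<in> limiting_normal_cone \<Omega> z" and "y \<in> \<Omega>"
  shows "v \<bullet> (y - z) \<le> 0"
proof -
  obtain zs vs where lim: "zs \<longlonglongrightarrow> z" "vs \<longlonglongrightarrow> v"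
    and normal: "\<And>k. zs k \<in> \<Omega>" "\<And>k. vs k \<in> regular_normal_cone \<Omega> (zs k)"
    using assms(2) by (auto simp: limiting_normal_cone_def)
  have "vs k \<bullet> (y - zs k) \<le> 0" for k
  proof (rule regular_normal_cone_feasible_direction[OF normal(2)])
    have "\<forall>\<^sub>F t in at_right (0::real). t \<in> {0<..<1}"
      by (rule eventually_at_right_real) simp
    then show "\<forall>\<^sub>F t in at_right 0. zs k + t *\<^sub>R (y - zs k) \<in> \<Omega>"
    proof eventually_elim
      case (elim t)
      have "(1 - t) *\<^sub>R zs k + t *\<^sub>R y \<in> \<Omega>"
        using elim normal(1)[of k] assms(1,3) by (auto intro: convexD_alt)
      then show ?case
        by (simp add: algebra_simps)
    qed
  qed
  moreover have "(\<lambda>k. vs k \<bullet> (y - zs k)) \<longlonglongrightarrow> v \<bullet> (y - z)"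
    by (intro tendsto_intros lim)
  ultimately show ?thesis
    by (auto intro: LIMSEQ_le_const2)
qed

lemma subdiff_convex:
  fixes f :: "'a::euclidean_space \<Rightarrow> real"
  assumes "convex_on UNIV f"
  shows "subdiff (\<lambda>x. ereal (f x)) x = {v. \<forall>y. f x + v \<bullet> (y - x) \<le> f y}"
proof -
  let ?E = "epi (\<lambda>x. ereal (f x))"
  have convex: "convex ?E"
    using convex_epigraph[of UNIV f] assms by (auto simp: epi_def epigraph_def case_prod_unfold)
  have "f x + v \<bullet> (y - x) \<le> f y" if "(v, -1) \<in> limiting_normal_cone ?E (x, f x)" for v y
    using limiting_normal_cone_convex[OF convex that, of "(y, f y)"] by (simp add: epi_def)
  moreover have "(v, -1) \<in> limiting_normal_cone ?E (x, f x)"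
    if v: "\<And>y. f x + v \<bullet> (y - x) \<le> f y" for v
  proof -
    have "(v, -1) \<bullet> ((y, r) - (x, f x)) \<le> 0" if "(y, r) \<in> ?E" for y r
      using that v[of y] by (simp add: epi_def)
    then have "(v, -1) \<in> regular_normal_cone ?E (x, f x)"
      by (intro regular_normal_coneI always_eventually) (auto simp: epi_def)
    then show ?thesis
      using regular_normal_cone_subset_limiting by blast
  qed
  ultimately show ?thesis
    by (auto simp: subdiff_def)
qed

text \<open>A function with an affine minorant touching it at every point is a supremum of affine functions.\<close>

lemma convex_onI_subgradient:
  fixes f :: "'a::real_inner \<Rightarrow> real"
  assumes "\<And>x. \<exists>v. \<forall>y. f x + v \<bullet> (y - x) \<le> f y"
  shows "convex_on UNIV f"
proof (rule convex_onI)
  fix t :: real and x y :: 'a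
  assume t: "0 < t" "t < 1"
  let ?z = "(1 - t) *\<^sub>R x + t *\<^sub>R y"
  obtain v where v: "\<And>y. f ?z + v \<bullet> (y - ?z) \<le> f y"
    using assms[of ?z] by blast
  have "(1 - t) * (f ?z + v \<bullet> (x - ?z)) + t * (f ?z + v \<bullet> (y - ?z))
      \<le> (1 - t) * f x + t * f y"
    using t by (intro add_mono mult_left_mono v) auto
  also have "(1 - t) * (f ?z + v \<bullet> (x - ?z)) + t * (f ?z + v \<bullet> (y - ?z)) = f ?z"
    by (simp add: inner_simps algebra_simps)
  finally show "f ?z \<le> (1 - t) * f x + t * f y" .
qed simp


section \<open>The subdifferential of the Lasso objective\<close>

definition lasso_real :: "real ^ 'n ^ 'm \<Rightarrow> real ^ 'm \<Rightarrow> real \<Rightarrow> real ^ 'n \<Rightarrow> real" where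
  "lasso_real A b \<mu> x = 1 / 2 * (norm (A *v x - b))\<^sup>2 + \<mu> * l1_norm x"

definition lasso_grad :: "real ^ 'n ^ 'm \<Rightarrow> real ^ 'm \<Rightarrow> real ^ 'n \<Rightarrow> real ^ 'n" where
  "lasso_grad A b x = transpose A *v (A *v x - b)"

text \<open>The subdifferential of \<open>\<mu>\<parallel>\<cdot>\<parallel>\<^sub>1\<close> in its Fenchel-equality form, which needs no case distinction on the
  sign of \<open>x\<^sub>i\<close>.\<close>

definition l1_subgrad :: "real \<Rightarrow> real ^ 'n \<Rightarrow> (real ^ 'n) set" where
  "l1_subgrad \<mu> x = {y. \<forall>i. \<bar>y $ i\<bar> \<le> \<mu> \<and> y $ i * x $ i = \<mu> * \<bar>x $ i\<bar>}"

lemma lasso_eq_lasso_real: "lasso A b \<mu> = (\<lambda>x. ereal (lasso_real A b \<mu> x))"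
  by (simp add: fun_eq_iff lasso_def lasso_real_def)

lemma lasso_reg_eq_lasso: "lasso_reg \<mu> = lasso (0 :: real ^ 'n ^ 'm::finite) 0 \<mu>"
  by (simp add: fun_eq_iff lasso_def lasso_reg_def)

lemma inner_transpose_mult: "(transpose A *v r) \<bullet> h = r \<bullet> (A *v (h :: real ^ 'n))"
  by (simp add: dot_lmul_matrix transpose_matrix_vector)

lemma matrix_vector_mult_minus: "A *v (- x) = - (A *v x)" for A :: "real ^ 'n ^ 'm"
  using matrix_vector_mult_scaleR[of A "- 1" x] by simp

lemma lasso_grad_diff:
  "lasso_grad A b x' - lasso_grad A b x = transpose A *v (A *v (x' - x))"
  by (simp add: lasso_grad_def matrix_vector_mult_diff_distrib)

lemma lasso_grad_alt:
  "lasso_grad A b x = (transpose A ** A) *v x - transpose A *v b"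
  by (simp add: lasso_grad_def matrix_vector_mult_diff_distrib matrix_vector_mul_assoc)

lemma continuous_lasso_grad: "continuous_on S (lasso_grad A b)"
  unfolding lasso_grad_def
  by (intro continuous_intros matrix_vector_mult_linear_continuous_on
      linear_continuous_on_compose[OF _ matrix_vector_mul_linear])

lemma tendsto_lasso_grad [tendsto_intros]:
  assumes "(f \<longlongrightarrow> x) F"
  shows "((\<lambda>t. lasso_grad A b (f t)) \<longlongrightarrow> lasso_grad A b x) F"
  using continuous_lasso_grad[of UNIV A b] assms
  by (metis continuous_on_eq_continuous_at isCont_tendsto_compose open_UNIV UNIV_I)

text \<open>The last sum collects the excess of \<open>\<mu>\<bar>\<cdot>\<bar>\<close> over its affine minorant with slope \<open>y\<^sub>i\<close> at \<open>x\<^sub>i\<close>. For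
  a subgradient \<open>y\<close> its terms are nonnegative, which yields optimality, uniqueness and monotonicity
  statements with an explicit quadratic gain.\<close>

lemma lasso_expansion:
  "lasso_real A b \<mu> x' = lasso_real A b \<mu> x + (lasso_grad A b x + y) \<bullet> (x' - x)
     + 1 / 2 * (norm (A *v (x' - x)))\<^sup>2
     + (\<Sum>i\<in>UNIV. \<mu> * \<bar>x' $ i\<bar> - \<mu> * \<bar>x $ i\<bar> - y $ i * (x' $ i - x $ i))"
proof -
  define r h where "r = A *v x - b" and "h = A *v (x' - x)"
  have "A *v x' - b = r + h"
    by (simp add: r_def h_def matrix_vector_mult_diff_distrib)
  then have "(norm (A *v x' - b))\<^sup>2 = (norm r)\<^sup>2 + 2 * (r \<bullet> h) + (norm h)\<^sup>2"
    by (simp add: power2_norm_eq_inner inner_simps inner_commute)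
  moreover have "lasso_grad A b x \<bullet> (x' - x) = r \<bullet> h"
    unfolding lasso_grad_def inner_transpose_mult r_def h_def ..
  moreover have "(\<Sum>i\<in>UNIV. \<mu> * \<bar>x' $ i\<bar> - \<mu> * \<bar>x $ i\<bar> - y $ i * (x' $ i - x $ i))
      = \<mu> * l1_norm x' - \<mu> * l1_norm x - y \<bullet> (x' - x)"
    by (simp add: l1_norm_def sum_subtractf sum_distrib_left inner_vec_def)
  ultimately show ?thesis
    by (simp add: lasso_real_def inner_add_left r_def[symmetric] h_def[symmetric])
qed

lemma l1_subgrad_excess_nonneg:
  assumes "y \<in> l1_subgrad \<mu> x"
  shows "0 \<le> \<mu> * \<bar>x' $ i\<bar> - \<mu> * \<bar>x $ i\<bar> - y $ i * (x' $ i - x $ i)"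
proof -
  have "y $ i * x' $ i \<le> \<bar>y $ i\<bar> * \<bar>x' $ i\<bar>"
    by (metis abs_ge_self abs_mult)
  also have "\<dots> \<le> \<mu> * \<bar>x' $ i\<bar>"
    using assms by (auto simp: l1_subgrad_def intro: mult_right_mono)
  finally show ?thesis
    using assms by (auto simp: l1_subgrad_def algebra_simps)
qed

lemma l1_subgrad_sgn:
  assumes "y \<in> l1_subgrad \<mu> x" and "x $ i \<noteq> 0"
  shows "y $ i = \<mu> * sgn (x $ i)"
proof -
  have "(y $ i - \<mu> * sgn (x $ i)) * x $ i = 0"
    using assms(1) by (auto simp: l1_subgrad_def algebra_simps abs_sgn)
  then show ?thesis
    using assms(2) by simp
qed

lemma l1_subgrad_active:
  assumes "y \<in> l1_subgrad \<mu> x" and "x $ i \<noteq> 0"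
  shows "\<bar>y $ i\<bar> = \<mu>"
proof -
  have "\<bar>y $ i\<bar> \<le> \<mu>"
    using assms(1) by (simp add: l1_subgrad_def)
  then show ?thesis
    using assms(2) by (simp add: l1_subgrad_sgn[OF assms] abs_mult)
qed

lemma lasso_strong_subgradient:
  assumes "v - lasso_grad A b x \<in> l1_subgrad \<mu> x"
  shows "lasso_real A b \<mu> x + v \<bullet> (x' - x) + 1 / 2 * (norm (A *v (x' - x)))\<^sup>2
    \<le> lasso_real A b \<mu> x'"
  using lasso_expansion[of A b \<mu> x' x "v - lasso_grad A b x"] l1_subgrad_excess_nonneg[OF assms]
  by (simp add: sum_nonneg)

lemma lasso_subgradient:
  assumes "v - lasso_grad A b x \<in> l1_subgrad \<mu> x"
  shows "lasso_real A b \<mu> x + v \<bullet> (x' - x) \<le> lasso_real A b \<mu> x'"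
  by (rule order_trans[OF _ lasso_strong_subgradient[OF assms]]) simp

lemma convex_lasso_real:
  fixes A :: "real ^ 'n ^ 'm"
  assumes "\<mu> \<ge> 0" shows "convex_on UNIV (lasso_real A b \<mu>)"
proof (rule convex_onI_subgradient)
  fix x :: "real ^ 'n"
  define y where "y = (\<chi> i. \<mu> * sgn (x $ i))"
  have "y \<in> l1_subgrad \<mu> x"
    using assms by (auto simp: l1_subgrad_def y_def abs_mult sgn_real_def)
  then have "\<forall>x'. lasso_real A b \<mu> x + (lasso_grad A b x + y) \<bullet> (x' - x) \<le> lasso_real A b \<mu> x'"
    using lasso_subgradient[of "lasso_grad A b x + y" A b x \<mu>] by simp
  then show "\<exists>v. \<forall>x'. lasso_real A b \<mu> x + v \<bullet> (x' - x) \<le> lasso_real A b \<mu> x'" ..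
qed

lemma continuous_lasso_real: "\<mu> \<ge> 0 \<Longrightarrow> continuous_on S (lasso_real A b \<mu>)"
  using convex_on_continuous[OF open_UNIV convex_lasso_real] continuous_on_subset by blast

text \<open>Necessity is tested along coordinate directions: the directions \<open>e\<^sub>i\<close> and \<open>- e\<^sub>i\<close> give \<open>\<bar>y\<^sub>i\<bar> \<le> \<mu>\<close>,
  and the direction \<open>- x\<^sub>i e\<^sub>i\<close>, along which \<open>\<bar>x\<^sub>i\<bar>\<close> is linear, gives \<open>y\<^sub>i x\<^sub>i \<ge> \<mu>\<bar>x\<^sub>i\<bar>\<close>. The quadratic
  part contributes only in second order.\<close>

lemma lasso_subgradient_iff:
  assumes "\<mu> \<ge> 0"
  shows "(\<forall>x'. lasso_real A b \<mu> x + v \<bullet> (x' - x) \<le> lasso_real A b \<mu> x')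
    \<longleftrightarrow> v - lasso_grad A b x \<in> l1_subgrad \<mu> x" (is "?L \<longleftrightarrow> ?R")
proof
  assume L: ?L
  define y where "y = v - lasso_grad A b x"
  have test: "\<alpha> * y $ i \<le> \<beta>"
    if \<beta>: "\<And>t. 0 < t \<Longrightarrow> t \<le> 1 \<Longrightarrow> \<mu> * \<bar>x $ i + t * \<alpha>\<bar> - \<mu> * \<bar>x $ i\<bar> \<le> t * \<beta>" for i \<alpha> \<beta>
  proof -
    define C where "C = 1 / 2 * (norm (A *v (\<alpha> *\<^sub>R axis i 1)))\<^sup>2"
    have "\<alpha> * y $ i \<le> \<beta> + t * C" if t: "0 < t" "t \<le> 1" for t
    proof -
      define x' where "x' = x + t *\<^sub>R (\<alpha> *\<^sub>R axis i 1)"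
      have "norm (A *v (x' - x)) = t * norm (A *v (\<alpha> *\<^sub>R axis i 1))"
        using t unfolding x'_def add_diff_cancel_left' matrix_vector_mult_scaleR[of A t] by simp
      then have quad: "1 / 2 * (norm (A *v (x' - x)))\<^sup>2 = t\<^sup>2 * C"
        by (simp add: C_def power_mult_distrib)
      have "(\<Sum>j\<in>UNIV. \<mu> * \<bar>x' $ j\<bar> - \<mu> * \<bar>x $ j\<bar> - y $ j * (x' $ j - x $ j))
          = (\<Sum>j\<in>{i}. \<mu> * \<bar>x' $ j\<bar> - \<mu> * \<bar>x $ j\<bar> - y $ j * (x' $ j - x $ j))"
        by (rule sum.mono_neutral_right) (auto simp: x'_def axis_def)
      also have "\<dots> = \<mu> * \<bar>x $ i + t * \<alpha>\<bar> - \<mu> * \<bar>x $ i\<bar> - t * (\<alpha> * y $ i)"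
        by (simp add: x'_def)
      also have "\<dots> \<le> t * \<beta> - t * (\<alpha> * y $ i)"
        using \<beta>[OF t] by simp
      finally have "0 \<le> t\<^sup>2 * C + t * \<beta> - t * (\<alpha> * y $ i)"
        using L[rule_format, of x'] lasso_expansion[of A b \<mu> x' x y] quad
        by (simp add: y_def)
      then have "0 \<le> t * (t * C + \<beta> - \<alpha> * y $ i)"
        by (simp add: algebra_simps power2_eq_square)
      then show ?thesis
        using t by (simp add: zero_le_mult_iff)
    qed
    then have "\<forall>\<^sub>F t in at_right 0. \<alpha> * y $ i \<le> \<beta> + t * C"
      using eventually_at_right_real[of 0 1] by (auto elim: eventually_mono)
    moreover have "((\<lambda>t. \<beta> + t * C) \<longlongrightarrow> \<beta> + 0 * C) (at_right 0)"
      by (intro tendsto_intros)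
    ultimately have "\<alpha> * y $ i \<le> \<beta> + 0 * C"
      by (intro tendsto_lowerbound) auto
    then show ?thesis by simp
  qed
  have "\<bar>y $ i\<bar> \<le> \<mu>" for i
  proof -
    have "\<mu> * \<bar>x $ i + t * \<alpha>\<bar> - \<mu> * \<bar>x $ i\<bar> \<le> t * \<mu>" if "0 < t" "\<bar>\<alpha>\<bar> = 1" for t \<alpha>
    proof -
      have "\<mu> * \<bar>x $ i + t * \<alpha>\<bar> \<le> \<mu> * (\<bar>x $ i\<bar> + t)"
        using that assms abs_triangle_ineq[of "x $ i" "t * \<alpha>"]
        by (intro mult_left_mono) (auto simp: abs_mult)
      then show ?thesis by (simp add: algebra_simps)
    qed
    from test[of i 1 \<mu>, OF this] test[of i "-1" \<mu>, OF this] show ?thesis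
      by auto
  qed
  moreover have "y $ i * x $ i = \<mu> * \<bar>x $ i\<bar>" for i
  proof (rule antisym)
    have "\<mu> * \<bar>x $ i + t * - x $ i\<bar> - \<mu> * \<bar>x $ i\<bar> \<le> t * - (\<mu> * \<bar>x $ i\<bar>)"
      if "0 < t" "t \<le> 1" for t
    proof -
      have "x $ i + t * - x $ i = (1 - t) * x $ i" by (simp add: algebra_simps)
      then have abs: "\<bar>x $ i + t * - x $ i\<bar> = (1 - t) * \<bar>x $ i\<bar>"
        using that by (simp add: abs_mult)
      show ?thesis unfolding abs by (simp add: algebra_simps)
    qed
    from test[OF this] show "\<mu> * \<bar>x $ i\<bar> \<le> y $ i * x $ i"
      by (simp add: mult.commute)
    show "y $ i * x $ i \<le> \<mu> * \<bar>x $ i\<bar>"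
      using \<open>\<bar>y $ i\<bar> \<le> \<mu>\<close> by (metis abs_ge_self abs_ge_zero abs_mult mult_right_mono order_trans)
  qed
  ultimately show ?R
    by (simp add: l1_subgrad_def y_def)
next
  assume ?R
  then show ?L
    using lasso_subgradient by blast
qed

lemma subdiff_lasso:
  assumes "\<mu> \<ge> 0"
  shows "subdiff (lasso A b \<mu>) x = {v. v - lasso_grad A b x \<in> l1_subgrad \<mu> x}"
  by (simp add: lasso_eq_lasso_real subdiff_convex[OF convex_lasso_real[OF assms]]
      lasso_subgradient_iff[OF assms])

lemma subdiff_lasso_reg:
  fixes x :: "real ^ 'n"
  assumes "\<mu> \<ge> 0"
  shows "subdiff (lasso_reg \<mu>) x = l1_subgrad \<mu> x"
  by (simp add: lasso_reg_eq_lasso[where 'm = "'n"] subdiff_lasso[OF assms] lasso_grad_def)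


lemma mem_gph_subdiff_lasso:
  assumes "\<mu> \<ge> 0"
  shows "(x, v) \<in> gph (subdiff (lasso A b \<mu>)) \<longleftrightarrow> v - lasso_grad A b x \<in> l1_subgrad \<mu> x"
  by (simp add: gph_def subdiff_lasso[OF assms])


section \<open>Normals to the graph of the subdifferential\<close>

text \<open>Conditions satisfied by limiting normals \<open>(z, c)\<close> to the graph of the subdifferential of
  \<open>\<mu>\<parallel>\<cdot>\<parallel>\<^sub>1\<close> at \<open>(x, y)\<close>. In each coordinate the graph is a broken line with two horizontal rays and one
  vertical segment: \<open>z\<^sub>i\<close> vanishes on the rays and \<open>c\<^sub>i\<close> inside the segment. At the two corners the sign
  condition replaces the exact normal cone, a union of a quadrant and two lines; being the same
  at both corners, it avoids a case distinction.\<close>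

definition l1_normal_pair ::
    "real \<Rightarrow> real ^ 'n \<Rightarrow> real ^ 'n \<Rightarrow> real ^ 'n \<Rightarrow> real ^ 'n \<Rightarrow> bool" where
  "l1_normal_pair \<mu> x y z c \<longleftrightarrow>
    (\<forall>i. (x $ i \<noteq> 0 \<longrightarrow> z $ i = 0) \<and> (\<bar>y $ i\<bar> < \<mu> \<longrightarrow> c $ i = 0) \<and> z $ i * c $ i \<le> 0)"

text \<open>If a coordinate of \<open>(x, y)\<close> can be moved along \<open>(\<alpha>, \<beta>)\<close> within its broken line, then
  \<open>(\<alpha> e\<^sub>i, \<alpha> A\<^sup>TA e\<^sub>i + \<beta> e\<^sub>i)\<close> is a feasible direction for the sheared graph, and the normal satisfies
  \<open>\<alpha> z\<^sub>i + \<beta> c\<^sub>i \<le> 0\<close>. The three conditions come from moving both ways on a ray, both ways in the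
  segment, and away from a corner along either branch.\<close>

lemma regular_normal_lasso:
  assumes \<mu>: "\<mu> > 0"
    and normal: "(a, c) \<in> regular_normal_cone (gph (subdiff (lasso A b \<mu>))) (x, v)"
  shows "l1_normal_pair \<mu> x (v - lasso_grad A b x) (a + transpose A *v (A *v c)) c"
  unfolding l1_normal_pair_def
proof
  fix i
  define y z where "y = v - lasso_grad A b x" and "z = a + transpose A *v (A *v c)"
  have "(x, v) \<in> gph (subdiff (lasso A b \<mu>))"
    using normal by (simp add: regular_normal_cone_def)
  then have y: "y \<in> l1_subgrad \<mu> x"
    using \<mu> by (simp add: mem_gph_subdiff_lasso y_def)
  then have yi: "\<bar>y $ i\<bar> \<le> \<mu>" "y $ i * x $ i = \<mu> * \<bar>x $ i\<bar>"
    by (auto simp: l1_subgrad_def)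
  have test: "\<alpha> * z $ i + \<beta> * c $ i \<le> 0"
    if ev: "\<forall>\<^sub>F t in at_right 0. \<bar>y $ i + t * \<beta>\<bar> \<le> \<mu> \<and>
      (y $ i + t * \<beta>) * (x $ i + t * \<alpha>) = \<mu> * \<bar>x $ i + t * \<alpha>\<bar>" for \<alpha> \<beta>
  proof -
    define e :: "real ^ _" where "e = axis i 1"
    define h where "h = (\<alpha> *\<^sub>R e, transpose A *v (A *v (\<alpha> *\<^sub>R e)) + \<beta> *\<^sub>R e)"
    have "(a, c) \<bullet> h \<le> 0"
    proof (rule regular_normal_cone_feasible_direction[OF normal])
      show "\<forall>\<^sub>F t in at_right 0. (x, v) + t *\<^sub>R h \<in> gph (subdiff (lasso A b \<mu>))"
        using ev
      proof eventually_elim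
        case (elim t)
        let ?x = "x + t *\<^sub>R (\<alpha> *\<^sub>R e)"
        have "lasso_grad A b ?x - lasso_grad A b x = t *\<^sub>R (transpose A *v (A *v (\<alpha> *\<^sub>R e)))"
          unfolding lasso_grad_diff add_diff_cancel_left'
          by (simp only: matrix_vector_mult_scaleR)
        then have "v + t *\<^sub>R (transpose A *v (A *v (\<alpha> *\<^sub>R e)) + \<beta> *\<^sub>R e) - lasso_grad A b ?x
            = y + t *\<^sub>R (\<beta> *\<^sub>R e)"
          unfolding y_def scaleR_add_right by (simp add: algebra_simps)
        moreover have "y + t *\<^sub>R (\<beta> *\<^sub>R e) \<in> l1_subgrad \<mu> ?x"
          using y elim by (auto simp: l1_subgrad_def e_def axis_def)
        ultimately show ?case
          using \<mu> by (simp add: mem_gph_subdiff_lasso h_def)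
      qed
    qed
    moreover have "c \<bullet> (transpose A *v (A *v (\<alpha> *\<^sub>R e))) = (transpose A *v (A *v c)) \<bullet> (\<alpha> *\<^sub>R e)"
      by (metis inner_commute inner_transpose_mult)
    ultimately show ?thesis
      by (auto simp add: h_def z_def e_def inner_add_right inner_axis algebra_simps)
  qed
  have z0: "z $ i = 0" if "x $ i \<noteq> 0"
  proof -
    have "\<alpha> * z $ i \<le> 0" if "\<bar>\<alpha>\<bar> = 1" for \<alpha>
    proof -
      have "\<forall>\<^sub>F t in at_right 0. t \<in> {0<..<\<bar>x $ i\<bar>}"
        by (rule eventually_at_right_real) (use \<open>x $ i \<noteq> 0\<close> in simp)
      then have "\<forall>\<^sub>F t in at_right 0. \<bar>y $ i + t * 0\<bar> \<le> \<mu> \<and>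
          (y $ i + t * 0) * (x $ i + t * \<alpha>) = \<mu> * \<bar>x $ i + t * \<alpha>\<bar>"
      proof eventually_elim
        case (elim t)
        have "y $ i = \<mu> * sgn (x $ i)"
          using l1_subgrad_sgn[OF y \<open>x $ i \<noteq> 0\<close>] .
        moreover have "sgn (x $ i + t * \<alpha>) = sgn (x $ i)"
          using elim that by (auto simp: sgn_real_def abs_if split: if_splits)
        ultimately show ?case
          using yi(1) by (simp add: mult.assoc sgn_mult_self_eq) (metis mult.commute abs_sgn)
      qed
      from test[OF this] show ?thesis by simp
    qed
    from this[of 1] this[of "-1"] show ?thesis by simp
  qed
  have c0: "c $ i = 0" if "\<bar>y $ i\<bar> < \<mu>"
  proof -
    have "x $ i = 0"
      using l1_subgrad_active[OF y, of i] that by auto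
    have "\<beta> * c $ i \<le> 0" if "\<bar>\<beta>\<bar> = 1" for \<beta>
    proof -
      have "\<forall>\<^sub>F t in at_right 0. t \<in> {0<..<\<mu> - \<bar>y $ i\<bar>}"
        by (rule eventually_at_right_real) (use \<open>\<bar>y $ i\<bar> < \<mu>\<close> in simp)
      then have "\<forall>\<^sub>F t in at_right 0. \<bar>y $ i + t * \<beta>\<bar> \<le> \<mu> \<and>
          (y $ i + t * \<beta>) * (x $ i + t * 0) = \<mu> * \<bar>x $ i + t * 0\<bar>"
        by eventually_elim (use that \<open>x $ i = 0\<close> in \<open>auto simp: abs_if split: if_splits\<close>)
      from test[OF this] show ?thesis by simp
    qed
    from this[of 1] this[of "-1"] show ?thesis by simp
  qed
  have "z $ i * c $ i \<le> 0"
  proof (cases "x $ i = 0 \<and> \<bar>y $ i\<bar> = \<mu>")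
    case True
    \<comment> \<open>A corner: it can be left outwards along its ray, direction \<open>(s, 0)\<close>, or into the segment,
      direction \<open>(0, - s)\<close>.\<close>
    define s where "s = sgn (y $ i)"
    have s: "y $ i = s * \<mu>" "\<bar>s\<bar> = 1" "s * s = 1"
      using True \<mu> by (auto simp: s_def sgn_real_def)
    have ev: "\<forall>\<^sub>F t in at_right 0. t \<in> {0<..<2 * \<mu>}"
      by (rule eventually_at_right_real) (use \<mu> in simp)
    then have "\<forall>\<^sub>F t in at_right 0. \<bar>y $ i + t * 0\<bar> \<le> \<mu> \<and>
        (y $ i + t * 0) * (x $ i + t * s) = \<mu> * \<bar>x $ i + t * s\<bar>"
      by eventually_elim (use True s in \<open>auto simp: abs_mult\<close>)
    from test[OF this] have 1: "s * z $ i \<le> 0"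
      by simp
    from ev have "\<forall>\<^sub>F t in at_right 0. \<bar>y $ i + t * (- s)\<bar> \<le> \<mu> \<and>
        (y $ i + t * (- s)) * (x $ i + t * 0) = \<mu> * \<bar>x $ i + t * 0\<bar>"
      by eventually_elim (use True s in \<open>auto simp: abs_if split: if_splits\<close>)
    from test[OF this] have 2: "0 \<le> s * c $ i"
      by simp
    have "z $ i * c $ i = (s * z $ i) * (s * c $ i)"
      using s(3) by (simp add: algebra_simps)
    also have "\<dots> \<le> 0"
      using 1 2 by (rule mult_nonpos_nonneg)
    finally show ?thesis .
  qed (use z0 c0 yi in force)
  with z0 c0 show "(x $ i \<noteq> 0 \<longrightarrow> (a + transpose A *v (A *v c)) $ i = 0) \<and>
      (\<bar>(v - lasso_grad A b x) $ i\<bar> < \<mu> \<longrightarrow> c $ i = 0) \<and>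
      (a + transpose A *v (A *v c)) $ i * c $ i \<le> 0"
    by (simp add: y_def z_def)
qed

text \<open>The conditions survive the passage to the limit because \<open>x\<^sub>i \<noteq> 0\<close> and \<open>\<bar>y\<^sub>i\<bar> < \<mu>\<close> are open.\<close>

lemma limiting_normal_lasso:
  assumes \<mu>: "\<mu> > 0"
    and normal: "(a, c) \<in> limiting_normal_cone (gph (subdiff (lasso A b \<mu>))) (x, v)"
  shows "l1_normal_pair \<mu> x (v - lasso_grad A b x) (a + transpose A *v (A *v c)) c"
proof -
  define G where "G = gph (subdiff (lasso A b \<mu>))"
  obtain ps ns where lim: "ps \<longlonglongrightarrow> (x, v)" "ns \<longlonglongrightarrow> (a, c)"
    and normals: "\<And>k. ns k \<in> regular_normal_cone G (ps k)"
    using normal by (auto simp: limiting_normal_cone_def G_def)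
  define xs vs as cs where "xs k = fst (ps k)" and "vs k = snd (ps k)"
    and "as k = fst (ns k)" and "cs k = snd (ns k)" for k
  have lims: "xs \<longlonglongrightarrow> x" "vs \<longlonglongrightarrow> v" "as \<longlonglongrightarrow> a" "cs \<longlonglongrightarrow> c"
    using tendsto_fst[OF lim(1)] tendsto_snd[OF lim(1)] tendsto_fst[OF lim(2)] tendsto_snd[OF lim(2)]
    by (simp_all add: xs_def[abs_def] vs_def[abs_def] as_def[abs_def] cs_def[abs_def])
  define ys zs where "ys k = vs k - lasso_grad A b (xs k)"
    and "zs k = as k + transpose A *v (A *v cs k)" for k
  define y z where "y = v - lasso_grad A b x" and "z = a + transpose A *v (A *v c)"
  have pair: "l1_normal_pair \<mu> (xs k) (ys k) (zs k) (cs k)" for k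
    using regular_normal_lasso[OF \<mu>, of "as k" "cs k" A b "xs k" "vs k"] normals[of k]
    by (simp add: xs_def vs_def as_def cs_def ys_def zs_def G_def)
  have ys: "ys \<longlonglongrightarrow> y"
    unfolding ys_def y_def by (intro tendsto_intros lims)
  have mult: "(\<lambda>k. M *v f k) \<longlonglongrightarrow> M *v l" if "f \<longlonglongrightarrow> l" for M :: "real ^ _ ^ _" and f l
    by (rule bounded_linear.tendsto[OF matrix_vector_mul_bounded_linear that])
  have zs: "zs \<longlonglongrightarrow> z"
    unfolding zs_def z_def by (intro tendsto_add lims mult)
  have "l1_normal_pair \<mu> x y z c"
    unfolding l1_normal_pair_def
  proof (intro allI conjI impI)
    fix i
    have coord: "(\<lambda>k. xs k $ i) \<longlonglongrightarrow> x $ i" "(\<lambda>k. ys k $ i) \<longlonglongrightarrow> y $ i"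
      "(\<lambda>k. zs k $ i) \<longlonglongrightarrow> z $ i" "(\<lambda>k. cs k $ i) \<longlonglongrightarrow> c $ i"
      using lims ys zs by (auto intro: tendsto_vec_nth)
    show "z $ i = 0" if "x $ i \<noteq> 0"
    proof -
      have "\<forall>\<^sub>F k in sequentially. zs k $ i = 0"
        using tendsto_imp_eventually_ne[OF coord(1) that] pair
        by (auto simp: l1_normal_pair_def elim: eventually_mono)
      then show ?thesis
        using coord(3) tendsto_eventually tendsto_unique by (metis sequentially_bot)
    qed
    show "c $ i = 0" if "\<bar>y $ i\<bar> < \<mu>"
    proof -
      have "\<forall>\<^sub>F k in sequentially. cs k $ i = 0"
        using order_tendstoD(2)[OF tendsto_rabs[OF coord(2)] that] pair
        by (auto simp: l1_normal_pair_def elim: eventually_mono)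
      then show ?thesis
        using coord(4) tendsto_eventually tendsto_unique by (metis sequentially_bot)
    qed
    have "(\<lambda>k. zs k $ i * cs k $ i) \<longlonglongrightarrow> z $ i * c $ i"
      by (intro tendsto_mult coord)
    then show "z $ i * c $ i \<le> 0"
      using pair by (auto simp: l1_normal_pair_def intro: LIMSEQ_le_const2)
  qed
  then show ?thesis
    by (simp add: y_def z_def)
qed

text \<open>Under strict complementarity no coordinate sits at a corner, so the graph is locally affine and
  \<open>(a, c)\<close> is orthogonal to it.\<close>

lemma regular_normal_lassoI:
  assumes \<mu>: "\<mu> > 0"
    and graph: "v - lasso_grad A b x \<in> l1_subgrad \<mu> x"
    and strict: "\<And>i. x $ i = 0 \<Longrightarrow> \<bar>(v - lasso_grad A b x) $ i\<bar> < \<mu>"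
    and z0: "\<And>i. x $ i \<noteq> 0 \<Longrightarrow> (a + transpose A *v (A *v c)) $ i = 0"
    and c0: "\<And>i. x $ i = 0 \<Longrightarrow> c $ i = 0"
  shows "(a, c) \<in> regular_normal_cone (gph (subdiff (lasso A b \<mu>))) (x, v)"
proof (rule regular_normal_coneI)
  define y where "y = v - lasso_grad A b x"
  show "(x, v) \<in> gph (subdiff (lasso A b \<mu>))"
    using graph \<mu> by (simp add: mem_gph_subdiff_lasso)
  have "\<forall>\<^sub>F p in nhds (x, v). sgn (fst p $ i) = sgn (x $ i)" if "x $ i \<noteq> 0" for i
  proof -
    have lim: "((\<lambda>p. fst p $ i * sgn (x $ i)) \<longlongrightarrow> fst (x, v) $ i * sgn (x $ i)) (nhds (x, v))"
      by (intro tendsto_intros filterlim_ident)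
    have "\<forall>\<^sub>F p in nhds (x, v). 0 < fst p $ i * sgn (x $ i)"
      by (rule order_tendstoD(1)[OF lim]) (use that in \<open>simp add: sgn_real_def\<close>)
    then show ?thesis
      by eventually_elim (use that in \<open>auto simp: sgn_real_def split: if_splits\<close>)
  qed
  moreover have "\<forall>\<^sub>F p in nhds (x, v). \<bar>(snd p - lasso_grad A b (fst p)) $ i\<bar> < \<mu>"
    if "x $ i = 0" for i
  proof -
    have lim: "((\<lambda>p. \<bar>(snd p - lasso_grad A b (fst p)) $ i\<bar>)
        \<longlongrightarrow> \<bar>(snd (x, v) - lasso_grad A b (fst (x, v))) $ i\<bar>) (nhds (x, v))"
      by (intro tendsto_intros filterlim_ident)
    show ?thesis
      by (rule order_tendstoD(2)[OF lim]) (use strict[OF that] in simp)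
  qed
  ultimately have "\<forall>\<^sub>F p in nhds (x, v). \<forall>i. (x $ i \<noteq> 0 \<longrightarrow> sgn (fst p $ i) = sgn (x $ i)) \<and>
      (x $ i = 0 \<longrightarrow> \<bar>(snd p - lasso_grad A b (fst p)) $ i\<bar> < \<mu>)"
    by (intro eventually_all_finite eventually_conj) auto
  then show "\<forall>\<^sub>F p in nhds (x, v). p \<in> gph (subdiff (lasso A b \<mu>)) \<longrightarrow> (a, c) \<bullet> (p - (x, v)) \<le> 0"
  proof eventually_elim
    case (elim p)
    show ?case
    proof
      assume "p \<in> gph (subdiff (lasso A b \<mu>))"
      then obtain x' v' where p: "p = (x', v')" and y'_mem: "v' - lasso_grad A b x' \<in> l1_subgrad \<mu> x'"
        using \<mu> by (metis mem_gph_subdiff_lasso less_eq_real_def surj_pair)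
      define y' where "y' = v' - lasso_grad A b x'"
      have "(a + transpose A *v (A *v c)) $ i * (x' - x) $ i + c $ i * (y' - y) $ i = 0" for i
      proof (cases "x $ i = 0")
        case True
        then have "\<bar>y' $ i\<bar> < \<mu>"
          using elim p y'_def by auto
        then have "x' $ i = 0"
          using l1_subgrad_active[OF y'_mem, of i] unfolding y'_def by auto
        then show ?thesis
          using True c0 by simp
      next
        case False
        then have "x' $ i \<noteq> 0" "sgn (x' $ i) = sgn (x $ i)"
          using elim p by (auto simp: sgn_zero_iff)
        then have "y' $ i = y $ i"
          using l1_subgrad_sgn[OF y'_mem, of i] l1_subgrad_sgn[OF graph, of i] False by (simp add: y_def y'_def)
        then show ?thesis
          using z0[OF False] by simp
      qed
      then have "(a + transpose A *v (A *v c)) \<bullet> (x' - x) + c \<bullet> (y' - y) = 0"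
        by (simp add: inner_vec_def sum.distrib[symmetric])
      moreover have "v' - v = (y' - y) + transpose A *v (A *v (x' - x))"
        unfolding y_def y'_def lasso_grad_diff[symmetric, of A x' x b] by simp
      moreover have "c \<bullet> (transpose A *v (A *v (x' - x))) = (transpose A *v (A *v c)) \<bullet> (x' - x)"
        by (metis inner_commute inner_transpose_mult)
      ultimately show "(a, c) \<bullet> (p - (x, v)) \<le> 0"
        by (simp add: p inner_add_left inner_add_right)
    qed
  qed
qed

text \<open>Corners are reached as limits from inside the segment: shrinking the coordinates \<open>y\<^sub>i\<close> with
  \<open>x\<^sub>i = 0\<close> by factors \<open>s\<^sub>k < 1\<close> restores strict complementarity without changing the conditions
  on \<open>(a, c)\<close>.\<close>

lemma limiting_normal_lassoI:
  assumes \<mu>: "\<mu> > 0"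
    and graph: "v - lasso_grad A b x \<in> l1_subgrad \<mu> x"
    and z0: "\<And>i. x $ i \<noteq> 0 \<Longrightarrow> (a + transpose A *v (A *v c)) $ i = 0"
    and c0: "\<And>i. x $ i = 0 \<Longrightarrow> c $ i = 0"
  shows "(a, c) \<in> limiting_normal_cone (gph (subdiff (lasso A b \<mu>))) (x, v)"
proof -
  define y where "y = v - lasso_grad A b x"
  define s :: "nat \<Rightarrow> real" where "s k = 1 - inverse (real (Suc k))" for k
  have s: "0 \<le> s k" "s k < 1" for k
    by (simp_all add: s_def inverse_le_1_iff)
  define ys where "ys k = (\<chi> i. if x $ i = 0 then s k * y $ i else y $ i)" for k
  have "(a, c) \<in> regular_normal_cone (gph (subdiff (lasso A b \<mu>))) (x, lasso_grad A b x + ys k)" for k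
  proof (rule regular_normal_lassoI[OF \<mu> _ _ z0 c0])
    have y: "\<bar>y $ i\<bar> \<le> \<mu>" "y $ i * x $ i = \<mu> * \<bar>x $ i\<bar>" for i
      using graph by (auto simp: y_def l1_subgrad_def)
    have lt: "s k * \<bar>y $ i\<bar> < \<mu>" for i
      using mult_left_mono[OF y(1)[of i] s(1)[of k]] s(2)[of k] \<mu>
      by (smt (verit) mult_less_cancel_right2)
    show "lasso_grad A b x + ys k - lasso_grad A b x \<in> l1_subgrad \<mu> x"
      using y lt s by (auto simp: l1_subgrad_def ys_def abs_mult less_imp_le)
    show "\<bar>(lasso_grad A b x + ys k - lasso_grad A b x) $ i\<bar> < \<mu>" if "x $ i = 0" for i
      using lt[of i] that s[of k] by (simp add: ys_def abs_mult)
  qed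
  moreover have "(\<lambda>k. (x, lasso_grad A b x + ys k)) \<longlonglongrightarrow> (x, v)"
  proof -
    have "(\<lambda>k. 1 - inverse (real (Suc k))) \<longlonglongrightarrow> 1 - 0"
      by (intro tendsto_intros LIMSEQ_inverse_real_of_nat)
    then have s_lim: "s \<longlonglongrightarrow> 1"
      by (simp add: s_def[abs_def])
    have "ys \<longlonglongrightarrow> y"
    proof (rule vec_tendstoI)
      fix i
      show "(\<lambda>k. ys k $ i) \<longlonglongrightarrow> y $ i"
        using tendsto_mult_right[OF s_lim, of "y $ i"] by (cases "x $ i = 0") (simp_all add: ys_def)
    qed
    then have "(\<lambda>k. (x, lasso_grad A b x + ys k)) \<longlonglongrightarrow> (x, lasso_grad A b x + y)"
      by (intro tendsto_intros)
    then show ?thesis by (simp add: y_def)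
  qed
  moreover have "(x, v) \<in> gph (subdiff (lasso A b \<mu>))"
    using graph \<mu> by (simp add: mem_gph_subdiff_lasso)
  ultimately show ?thesis
    unfolding limiting_normal_cone_def
    by (intro CollectI conjI exI[of _ "\<lambda>k. (x, lasso_grad A b x + ys k)"] exI[of _ "\<lambda>_. (a, c)"])
      (auto simp: regular_normal_cone_def)
qed


lemma limiting_normal_lasso_reg:
  fixes x :: "real ^ 'n"
  assumes "\<mu> > 0" and "(a, c) \<in> limiting_normal_cone (gph (subdiff (lasso_reg \<mu>))) (x, y)"
  shows "l1_normal_pair \<mu> x y a c"
  using limiting_normal_lasso[OF assms(1), where A = "0 :: real ^ 'n ^ 'n" and b = 0] assms(2)
  by (simp add: lasso_reg_eq_lasso[where 'm = 'n] lasso_grad_def)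

lemma limiting_normal_lasso_regI:
  fixes x :: "real ^ 'n"
  assumes "\<mu> > 0" and "y \<in> l1_subgrad \<mu> x"
    and "\<And>i. x $ i \<noteq> 0 \<Longrightarrow> a $ i = 0" and "\<And>i. x $ i = 0 \<Longrightarrow> c $ i = 0"
  shows "(a, c) \<in> limiting_normal_cone (gph (subdiff (lasso_reg \<mu>))) (x, y)"
  using limiting_normal_lassoI[OF assms(1), where A = "0 :: real ^ 'n ^ 'n" and b = 0, of y x a c] assms
  by (simp add: lasso_reg_eq_lasso[where 'm = 'n] lasso_grad_def)


section \<open>Soft thresholding\<close>

text \<open>Subtracting the projection onto \<open>[- \<tau>, \<tau>]\<close> makes continuity and the residual
  \<open>u - soft_threshold \<tau> u\<close> immediate.\<close>

definition soft_threshold :: "real \<Rightarrow> real ^ 'n \<Rightarrow> real ^ 'n" where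
  "soft_threshold \<tau> u = (\<chi> i. u $ i - max (- \<tau>) (min \<tau> (u $ i)))"

lemma soft_threshold_residual:
  assumes "\<mu> > 0" and "\<gamma> > 0"
  shows "(1 / \<gamma>) *\<^sub>R (u - soft_threshold (\<gamma> * \<mu>) u) \<in> l1_subgrad \<mu> (soft_threshold (\<gamma> * \<mu>) u)"
proof -
  have \<tau>: "\<gamma> * \<mu> > 0"
    using assms by simp
  have "\<bar>max (- (\<gamma> * \<mu>)) (min (\<gamma> * \<mu>) s)\<bar> \<le> \<gamma> * \<mu> \<and>
      max (- (\<gamma> * \<mu>)) (min (\<gamma> * \<mu>) s) * (s - max (- (\<gamma> * \<mu>)) (min (\<gamma> * \<mu>) s))
        = \<gamma> * \<mu> * \<bar>s - max (- (\<gamma> * \<mu>)) (min (\<gamma> * \<mu>) s)\<bar>" for s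
    using \<tau> by (auto simp: max_def min_def abs_if algebra_simps)
  then show ?thesis
    using assms by (simp add: l1_subgrad_def soft_threshold_def field_simps)
qed

text \<open>The proximal objective grows quadratically around a point satisfying the optimality condition,
  hence has no other minimizer.\<close>

lemma prox_lasso_reg:
  fixes u v :: "real ^ 'n"
  assumes "\<mu> > 0" and "\<gamma> > 0" and y: "(1 / \<gamma>) *\<^sub>R (u - v) \<in> l1_subgrad \<mu> v"
  shows "prox \<gamma> (lasso_reg \<mu>) u = {v}"
proof -
  define f where "f x = \<mu> * l1_norm x + 1 / (2 * \<gamma>) * (norm (x - u))\<^sup>2" for x :: "real ^ 'n"
  have growth: "f v + 1 / (2 * \<gamma>) * (norm (x - v))\<^sup>2 \<le> f x" for x
  proof -
    have "\<mu> * l1_norm v + ((1 / \<gamma>) *\<^sub>R (u - v)) \<bullet> (x - v) \<le> \<mu> * l1_norm x"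
      using lasso_subgradient[of "(1 / \<gamma>) *\<^sub>R (u - v)" "0 :: real ^ 'n ^ 'n" 0 v \<mu> x] y
      by (simp add: lasso_grad_def lasso_real_def)
    then have "\<mu> * l1_norm v + 1 / \<gamma> * ((u - v) \<bullet> (x - v)) \<le> \<mu> * l1_norm x"
      unfolding inner_scaleR_left .
    moreover have sq: "(norm (x - u))\<^sup>2 = (norm (x - v))\<^sup>2 + (norm (v - u))\<^sup>2 - 2 * ((u - v) \<bullet> (x - v))"
      by (simp add: power2_norm_eq_inner inner_diff_left inner_diff_right inner_commute)
    then have "1 / (2 * \<gamma>) * (norm (x - u))\<^sup>2
        = 1 / (2 * \<gamma>) * (norm (x - v))\<^sup>2 + 1 / (2 * \<gamma>) * (norm (v - u))\<^sup>2
          - 1 / \<gamma> * ((u - v) \<bullet> (x - v))"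
      unfolding sq using assms(2) by (simp add: field_simps)
    ultimately show ?thesis
      unfolding f_def by linarith
  qed
  have "f v \<le> f x" for x
    using growth[of x] assms(2) by (smt (verit) divide_nonneg_pos mult_nonneg_nonneg zero_le_power2)
  moreover have "x = v" if "f x \<le> f v" for x
  proof -
    have "1 / (2 * \<gamma>) * (norm (x - v))\<^sup>2 \<le> 0"
      using growth[of x] that by linarith
    then show ?thesis
      using assms(2) by (simp add: divide_le_0_iff)
  qed
  moreover have "prox \<gamma> (lasso_reg \<mu>) u = {x. \<forall>x'. f x \<le> f x'}"
    by (simp add: prox_def argmin_set_def is_arg_min_def lasso_reg_def f_def not_less)
  ultimately show ?thesis
    by auto
qed

lemma soft_threshold_eqI:
  assumes "\<mu> > 0" and "\<gamma> > 0" and "(1 / \<gamma>) *\<^sub>R (u - v) \<in> l1_subgrad \<mu> v"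
  shows "soft_threshold (\<gamma> * \<mu>) u = v"
  using prox_lasso_reg[OF assms] prox_lasso_reg[OF assms(1,2) soft_threshold_residual[OF assms(1,2)], of u]
  by simp

lemma tendsto_soft_threshold [tendsto_intros]:
  assumes "(f \<longlongrightarrow> u) F"
  shows "((\<lambda>t. soft_threshold \<tau> (f t)) \<longlongrightarrow> soft_threshold \<tau> u) F"
  unfolding soft_threshold_def by (intro vec_tendstoI) (simp, intro tendsto_intros assms)


section \<open>Nondegeneracy and metric regularity\<close>

text \<open>The last assumption says that the Gram matrix \<open>A\<^sup>TA\<close> restricted to the active coordinates is
  positive definite.\<close>

locale nondegenerate_lasso =
  fixes A :: "real ^ 'n ^ 'm" and b :: "real ^ 'm" and \<mu> :: real and xbar p :: "real ^ 'n"
  assumes mu_pos: "\<mu> > 0"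
    and p_mem: "p \<in> l1_subgrad \<mu> xbar"
    and stationary: "lasso_grad A b xbar = - p"
    and inj_active: "\<And>\<xi>. \<forall>i. \<xi> $ i \<noteq> 0 \<longrightarrow> \<bar>p $ i\<bar> = \<mu> \<Longrightarrow> A *v \<xi> = 0 \<Longrightarrow> \<xi> = 0"

text \<open>Let \<open>A\<xi> = 0\<close> with \<open>\<xi>\<close> supported in the active set. At \<open>x0\<close>, a small move from \<open>xbar\<close> along
  \<open>s = sgn p\<close>, the residual \<open>v0\<close> has the same subgradient \<open>p\<close>, and all active coordinates of \<open>x0\<close>
  are nonzero. Metric regularity provides preimages \<open>x'\<close> of \<open>v0 + e \<xi>\<close> at distance \<open>O(e)\<close> from \<open>x0\<close>; for small
  \<open>e\<close> their subgradients coincide with \<open>p\<close> on the active set. The increment \<open>e \<xi>\<close> of the residual is then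
  the sum of a vector in the range of \<open>A\<^sup>T\<close> and a vector vanishing on the active set, and both are
  orthogonal to \<open>\<xi>\<close>.\<close>

lemma nondegenerate_if_metrically_regular:
  fixes A :: "real ^ 'n ^ 'm"
  assumes \<mu>: "\<mu> > 0"
    and regular: "metrically_regular_around (subdiff (lasso A b \<mu>)) (xbar, 0)"
  shows "nondegenerate_lasso A b \<mu> xbar (- lasso_grad A b xbar)"
proof
  define p where "p = - lasso_grad A b xbar"
  let ?S = "subdiff (lasso A b \<mu>)"
  obtain \<kappa> U V where \<kappa>: "\<kappa> > 0" and U: "open U" "xbar \<in> U" and V: "open V" "0 \<in> V"
    and est: "\<And>x y. x \<in> U \<Longrightarrow> y \<in> V \<Longrightarrow> edist_set x {x'. y \<in> ?S x'} \<le> ereal \<kappa> * edist_set y (?S x)"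
    and graph: "(xbar, 0) \<in> gph ?S"
    using regular unfolding metrically_regular_around_def by auto
  show "\<mu> > 0" "lasso_grad A b xbar = - (- lasso_grad A b xbar)"
    using \<mu> by simp_all
  show p_mem: "- lasso_grad A b xbar \<in> l1_subgrad \<mu> xbar"
    using graph \<mu> by (simp add: mem_gph_subdiff_lasso)
  then have p: "\<bar>p $ i\<bar> \<le> \<mu>" "p $ i * xbar $ i = \<mu> * \<bar>xbar $ i\<bar>" for i
    by (auto simp: p_def l1_subgrad_def)
  fix \<xi> :: "real ^ 'n"
  assume "\<forall>i. \<xi> $ i \<noteq> 0 \<longrightarrow> \<bar>(- lasso_grad A b xbar) $ i\<bar> = \<mu>" and ker: "A *v \<xi> = 0"
  then have supp: "\<xi> $ i \<noteq> 0 \<Longrightarrow> \<bar>p $ i\<bar> = \<mu>" for i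
    by (simp add: p_def)
  define s where "s = (\<chi> i. if \<bar>p $ i\<bar> = \<mu> then sgn (p $ i) else 0)"
  have "((\<lambda>t. xbar + t *\<^sub>R s) \<longlongrightarrow> xbar + 0 *\<^sub>R s) (at_right 0)"
    by (intro tendsto_intros)
  then have x_lim: "((\<lambda>t. xbar + t *\<^sub>R s) \<longlongrightarrow> xbar) (at_right 0)" by simp
  then have v_lim: "((\<lambda>t. lasso_grad A b (xbar + t *\<^sub>R s) + p) \<longlongrightarrow> lasso_grad A b xbar + p) (at_right 0)"
    by (intro tendsto_intros)
  have "\<forall>\<^sub>F t in at_right (0::real). lasso_grad A b (xbar + t *\<^sub>R s) + p \<in> V"
    by (rule topological_tendstoD[OF v_lim V(1)]) (use V(2) in \<open>simp add: p_def\<close>)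
  with topological_tendstoD[OF x_lim U] eventually_at_right_less[of "0::real"]
  have "\<forall>\<^sub>F t in at_right (0::real). t > 0 \<and> xbar + t *\<^sub>R s \<in> U \<and> lasso_grad A b (xbar + t *\<^sub>R s) + p \<in> V"
    by eventually_elim simp
  then obtain t where t: "t > 0" "xbar + t *\<^sub>R s \<in> U" "lasso_grad A b (xbar + t *\<^sub>R s) + p \<in> V"
    using eventually_happens[of _ "at_right (0::real)"] by auto
  define x0 v0 where "x0 = xbar + t *\<^sub>R s" and "v0 = lasso_grad A b x0 + p"
  have x0: "p $ i * x0 $ i = \<mu> * \<bar>x0 $ i\<bar>" "\<bar>p $ i\<bar> = \<mu> \<longrightarrow> x0 $ i \<noteq> 0" for i
  proof -
    have "p $ i * x0 $ i = \<mu> * \<bar>x0 $ i\<bar> \<and> x0 $ i \<noteq> 0" if active: "\<bar>p $ i\<bar> = \<mu>"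
    proof -
      define \<sigma> where "\<sigma> = sgn (p $ i)"
      have \<sigma>: "p $ i = \<sigma> * \<mu>" "\<sigma> * \<sigma> = 1" "\<bar>\<sigma>\<bar> = 1"
        using active \<mu> by (auto simp: \<sigma>_def sgn_real_def)
      have "\<mu> * (\<sigma> * xbar $ i) = \<mu> * \<bar>xbar $ i\<bar>"
        using p(2)[of i] \<sigma>(1) by (simp add: ac_simps)
      then have "\<sigma> * xbar $ i = \<bar>xbar $ i\<bar>"
        using \<mu> by simp
      then have *: "\<sigma> * x0 $ i = \<bar>xbar $ i\<bar> + t"
        using active \<sigma>(2) by (simp add: x0_def s_def \<sigma>_def[symmetric] algebra_simps)
      moreover have "\<bar>x0 $ i\<bar> = \<bar>\<sigma> * x0 $ i\<bar>"
        using \<sigma>(3) by (simp add: abs_mult)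
      ultimately have "\<bar>x0 $ i\<bar> = \<bar>xbar $ i\<bar> + t"
        using t(1) by simp
      with * \<sigma>(1) t(1) show ?thesis
        by (auto simp: ac_simps)
    qed
    moreover have "x0 $ i = 0" if "\<bar>p $ i\<bar> \<noteq> \<mu>"
      using that p_mem l1_subgrad_active[of p \<mu> xbar i] by (auto simp: x0_def s_def p_def)
    ultimately show "p $ i * x0 $ i = \<mu> * \<bar>x0 $ i\<bar>" "\<bar>p $ i\<bar> = \<mu> \<longrightarrow> x0 $ i \<noteq> 0"
      by (cases "\<bar>p $ i\<bar> = \<mu>"; simp)+
  qed
  then have "v0 \<in> ?S x0"
    using p(1) \<mu> by (simp add: subdiff_lasso v0_def l1_subgrad_def)
  define Y where "Y q = v0 + snd q *\<^sub>R \<xi> - lasso_grad A b (fst q)" for q :: "(real ^ 'n) \<times> real"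
  have Y_lim: "(Y \<longlongrightarrow> v0 + snd (x0, 0) *\<^sub>R \<xi> - lasso_grad A b (fst (x0, 0::real))) (nhds (x0, 0))"
    unfolding Y_def[abs_def] by (intro tendsto_intros filterlim_ident)
  have "\<forall>\<^sub>F q in nhds (x0, 0). \<forall>i. \<bar>p $ i\<bar> = \<mu> \<longrightarrow> fst q $ i \<noteq> 0 \<and> 0 < Y q $ i * p $ i"
  proof (rule eventually_all_finite)
    fix i
    show "\<forall>\<^sub>F q in nhds (x0, 0). \<bar>p $ i\<bar> = \<mu> \<longrightarrow> fst q $ i \<noteq> 0 \<and> 0 < Y q $ i * p $ i"
    proof (cases "\<bar>p $ i\<bar> = \<mu>")
      case True
      have lim: "((\<lambda>q. fst q $ i) \<longlongrightarrow> fst (x0, 0::real) $ i) (nhds (x0, 0::real))"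
        by (intro tendsto_intros filterlim_ident)
      have lim': "((\<lambda>q. Y q $ i * p $ i) \<longlongrightarrow> p $ i * p $ i) (nhds (x0, 0))"
        using Y_lim by (intro tendsto_intros) (simp add: v0_def)
      have "\<forall>\<^sub>F q in nhds (x0, 0::real). fst q $ i \<noteq> 0"
        by (rule tendsto_imp_eventually_ne[OF lim]) (use x0(2) True in simp)
      moreover have "\<forall>\<^sub>F q in nhds (x0, 0). 0 < Y q $ i * p $ i"
        by (rule order_tendstoD(1)[OF lim']) (use True \<mu> in \<open>auto simp: zero_less_mult_iff\<close>)
      ultimately show ?thesis
        by eventually_elim simp
    qed simp
  qed
  then obtain P Q where P: "eventually P (nhds x0)" and Q: "eventually Q (nhds (0::real))"
    and PQ: "\<And>x e i. P x \<Longrightarrow> Q e \<Longrightarrow> \<bar>p $ i\<bar> = \<mu> \<Longrightarrow> x $ i \<noteq> 0 \<and> 0 < Y (x, e) $ i * p $ i"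
    unfolding nhds_prod eventually_prod_filter by auto
  obtain d where d: "d > 0" "\<And>x. dist x x0 < d \<Longrightarrow> P x"
    using P unfolding eventually_nhds_metric by blast
  \<comment> \<open>The summand \<open>1\<close> turns the estimate \<open>\<kappa> e \<parallel>\<xi>\<parallel>\<close> on the infimal distance into a strict bound, so that
    some preimage attains it.\<close>
  define C where "C = \<kappa> * norm \<xi> + 1"
  have "C > 0" using \<kappa> by (simp add: C_def add_nonneg_pos)
  have lim: "((\<lambda>e. v0 + e *\<^sub>R \<xi>) \<longlongrightarrow> v0 + 0 *\<^sub>R \<xi>) (at_right 0)"
    by (intro tendsto_intros)
  have "\<forall>\<^sub>F e in at_right (0::real). v0 + e *\<^sub>R \<xi> \<in> V"
    by (rule topological_tendstoD[OF lim V(1)]) (use t(3) in \<open>simp add: v0_def x0_def\<close>)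
  moreover have "\<forall>\<^sub>F e in at_right (0::real). Q e"
    using Q by (simp add: eventually_at_filter eventually_mono)
  moreover have "\<forall>\<^sub>F e in at_right (0::real). e \<in> {0<..<d / C}"
    by (rule eventually_at_right_real) (use d \<open>C > 0\<close> in simp)
  ultimately have "\<forall>\<^sub>F e in at_right (0::real). v0 + e *\<^sub>R \<xi> \<in> V \<and> Q e \<and> e \<in> {0<..<d / C}"
    by eventually_elim simp
  then obtain e where e: "v0 + e *\<^sub>R \<xi> \<in> V" "Q e" "0 < e" "e < d / C"
    using eventually_happens[of _ "at_right (0::real)"] by auto
  have "edist_set (v0 + e *\<^sub>R \<xi>) (?S x0) \<le> ereal (dist (v0 + e *\<^sub>R \<xi>) v0)"
    unfolding edist_set_def by (rule INF_lower) fact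
  then have "edist_set (v0 + e *\<^sub>R \<xi>) (?S x0) \<le> ereal (e * norm \<xi>)"
    using e(3) by (simp add: dist_norm)
  then have "ereal \<kappa> * edist_set (v0 + e *\<^sub>R \<xi>) (?S x0) \<le> ereal \<kappa> * ereal (e * norm \<xi>)"
    using \<kappa> by (intro ereal_mult_left_mono) auto
  also have "\<dots> < ereal (C * e)"
    using e(3) by (simp add: C_def algebra_simps)
  finally have "edist_set x0 {x'. v0 + e *\<^sub>R \<xi> \<in> ?S x'} < ereal (C * e)"
    using est[of x0 "v0 + e *\<^sub>R \<xi>"] t(2) e(1) by (simp add: x0_def)
  then obtain x' where x': "v0 + e *\<^sub>R \<xi> \<in> ?S x'" "dist x0 x' < C * e"
    unfolding edist_set_def INF_less_iff by auto
  have "P x'"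
    using d(2)[of x'] x'(2) e(4) \<open>C > 0\<close> by (simp add: dist_commute field_simps)
  define y' where "y' = Y (x', e)"
  have y': "y' \<in> l1_subgrad \<mu> x'" "v0 + e *\<^sub>R \<xi> = lasso_grad A b x' + y'"
    using x'(1) \<mu> by (simp_all add: subdiff_lasso y'_def Y_def)
  have orth: "(y' - p) $ i * \<xi> $ i = 0" for i
  proof (cases "\<xi> $ i = 0")
    case False
    then have "\<bar>p $ i\<bar> = \<mu>" by (rule supp)
    with PQ[OF \<open>P x'\<close> e(2)] have near: "x' $ i \<noteq> 0" "0 < y' $ i * p $ i"
      by (auto simp: y'_def)
    with l1_subgrad_active[OF y'(1)] have "\<bar>y' $ i\<bar> = \<mu>" by blast
    with near(2) \<open>\<bar>p $ i\<bar> = \<mu>\<close> show ?thesis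
      by (auto simp: abs_if zero_less_mult_iff split: if_splits)
  qed simp
  have "(y' - p) \<bullet> \<xi> = 0"
    by (simp only: inner_vec_def inner_real_def orth sum.neutral_const)
  moreover have "e *\<^sub>R \<xi> = (lasso_grad A b x' - lasso_grad A b x0) + (y' - p)"
    using y'(2) by (simp add: v0_def algebra_simps)
  ultimately have "e * (\<xi> \<bullet> \<xi>) = (transpose A *v (A *v (x' - x0))) \<bullet> \<xi>"
    unfolding lasso_grad_diff by (metis add.right_neutral inner_add_left inner_scaleR_left)
  then have "e * (\<xi> \<bullet> \<xi>) = 0"
    unfolding inner_transpose_mult by (simp add: ker)
  then show "\<xi> = 0"
    using e(3) by simp
qed

context nondegenerate_lasso
begin

lemma support_near: "\<forall>\<^sub>F x in nhds xbar. \<forall>i. x $ i = 0 \<longrightarrow> xbar $ i = 0"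
proof (rule eventually_all_finite)
  fix i
  have "((\<lambda>x. x $ i) \<longlongrightarrow> xbar $ i) (nhds xbar)"
    by (intro tendsto_intros filterlim_ident)
  from tendsto_imp_eventually_ne[OF this]
  show "\<forall>\<^sub>F x in nhds xbar. x $ i = 0 \<longrightarrow> xbar $ i = 0"
    by (cases "xbar $ i = 0") (auto elim: eventually_mono)
qed

text \<open>The two active values \<open>\<mu>\<close> and \<open>- \<mu>\<close> are at distance \<open>2\<mu>\<close>, so close to \<open>p\<close> an active coordinate can
  only have the value that it has in \<open>p\<close>.\<close>

lemma active_near: "\<forall>\<^sub>F y in nhds p. \<forall>i. \<bar>y $ i\<bar> = \<mu> \<longrightarrow> y $ i = p $ i"
proof (rule eventually_all_finite)
  fix i
  show "\<forall>\<^sub>F y in nhds p. \<bar>y $ i\<bar> = \<mu> \<longrightarrow> y $ i = p $ i"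
  proof (cases "\<bar>p $ i\<bar> = \<mu>")
    case True
    have lim: "((\<lambda>y. y $ i * p $ i) \<longlongrightarrow> p $ i * p $ i) (nhds p)"
      by (intro tendsto_intros filterlim_ident)
    have "\<forall>\<^sub>F y in nhds p. 0 < y $ i * p $ i"
      by (rule order_tendstoD(1)[OF lim]) (use True mu_pos in \<open>auto simp: zero_less_mult_iff\<close>)
    then show ?thesis
      by eventually_elim (use True in \<open>auto simp: abs_if zero_less_mult_iff split: if_splits\<close>)
  next
    case False
    then have "\<bar>p $ i\<bar> < \<mu>"
      using p_mem by (auto simp: l1_subgrad_def less_le)
    moreover have lim: "((\<lambda>y. \<bar>y $ i\<bar>) \<longlongrightarrow> \<bar>p $ i\<bar>) (nhds p)"
      by (intro tendsto_intros filterlim_ident)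
    ultimately have "\<forall>\<^sub>F y in nhds p. \<bar>y $ i\<bar> < \<mu>"
      using order_tendstoD(2) by blast
    then show ?thesis
      by eventually_elim simp
  qed
qed

lemma residual_near:
  "\<forall>\<^sub>F q in nhds (xbar, 0). \<forall>i. \<bar>(snd q - lasso_grad A b (fst q)) $ i\<bar> = \<mu> \<longrightarrow>
    (snd q - lasso_grad A b (fst q)) $ i = p $ i"
proof -
  have "((\<lambda>q. snd q - lasso_grad A b (fst q))
      \<longlongrightarrow> snd (xbar, 0) - lasso_grad A b (fst (xbar, 0 :: real ^ 'n))) (nhds (xbar, 0))"
    by (intro tendsto_intros filterlim_ident)
  then have "filterlim (\<lambda>q. snd q - lasso_grad A b (fst q)) (nhds p) (nhds (xbar, 0))"
    by (simp add: stationary)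
  from eventually_compose_filterlim[OF active_near this] show ?thesis .
qed

text \<open>The square system given by the principal submatrix of \<open>A\<^sup>TA\<close> on \<open>E\<close>, completed by the identity
  outside \<open>E\<close>, is injective by \<open>inj_active\<close> and therefore surjective.\<close>

lemma solvable_on_active:
  assumes "\<And>i. i \<in> E \<Longrightarrow> \<bar>p $ i\<bar> = \<mu>"
  shows "\<exists>w. (\<forall>i. i \<notin> E \<longrightarrow> w $ i = 0) \<and> (\<forall>i\<in>E. (transpose A *v (A *v w)) $ i = r $ i)"
proof -
  define R :: "real ^ 'n \<Rightarrow> real ^ 'n" where "R w = (\<chi> i. if i \<in> E then w $ i else 0)" for w
  define T :: "real ^ 'n \<Rightarrow> real ^ 'n"
    where "T w = (\<chi> i. if i \<in> E then (transpose A *v (A *v R w)) $ i else w $ i)" for w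
  have R: "R (u + w) = R u + R w" "R (t *\<^sub>R w) = t *\<^sub>R R w" for u w t
    by (simp_all add: R_def vec_eq_iff)
  have linear: "linear T"
  proof (rule linearI)
    show "T (u + w) = T u + T w" for u w
      by (simp add: T_def vec_eq_iff R matrix_vector_right_distrib)
    show "T (t *\<^sub>R w) = t *\<^sub>R T w" for t w
      by (simp add: T_def vec_eq_iff R matrix_vector_mult_scaleR)
  qed
  have "w = 0" if "T w = 0" for w
  proof -
    have T: "(if i \<in> E then (transpose A *v (A *v R w)) $ i else w $ i) = 0" for i
      using that by (simp add: T_def vec_eq_iff)
    have "w $ i = 0" if "i \<notin> E" for i
      using T[of i] that by simp
    then have Rw: "R w = w"
      by (simp add: R_def vec_eq_iff)
    have *: "(transpose A *v (A *v w)) $ i * w $ i = 0" for i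
      using T[of i] Rw by (auto split: if_splits)
    have "(transpose A *v (A *v w)) \<bullet> w = 0"
      by (simp only: inner_vec_def inner_real_def * sum.neutral_const)
    then have "A *v w = 0"
      unfolding inner_transpose_mult by simp
    moreover have "\<forall>i. w $ i \<noteq> 0 \<longrightarrow> \<bar>p $ i\<bar> = \<mu>"
      using T assms by metis
    ultimately show ?thesis
      using inj_active by blast
  qed
  then have "inj T"
    using linear_injective_0[OF linear] by blast
  then have "surj T"
    using linear_injective_imp_surjective[OF linear] by blast
  then obtain w where w: "T w = (\<chi> i. if i \<in> E then r $ i else 0)"
    by (metis surjD)
  then have w': "(if i \<in> E then (transpose A *v (A *v R w)) $ i else w $ i) = (if i \<in> E then r $ i else 0)" for i
    by (simp add: T_def vec_eq_iff)
  have "w $ i = 0" if "i \<notin> E" for i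
    using w'[of i] that by simp
  then have "R w = w"
    by (simp add: R_def vec_eq_iff)
  with w' show ?thesis
    by metis
qed


section \<open>Tilt stability\<close>

text \<open>Expanding around \<open>xbar\<close> with the subgradient \<open>p\<close>, both nonnegative remainders must vanish. The
  excess vanishes in an inactive coordinate only at zero, so \<open>x - xbar\<close> is supported in the active set
  and is annihilated by \<open>A\<close>.\<close>

lemma minimizer_unique:
  assumes "lasso_real A b \<mu> x \<le> lasso_real A b \<mu> xbar"
  shows "x = xbar"
proof -
  let ?e = "\<lambda>i. \<mu> * \<bar>x $ i\<bar> - \<mu> * \<bar>xbar $ i\<bar> - p $ i * (x $ i - xbar $ i)"
  have nonneg: "0 \<le> ?e i" for i
    by (rule l1_subgrad_excess_nonneg[OF p_mem])
  have "1 / 2 * (norm (A *v (x - xbar)))\<^sup>2 + (\<Sum>i\<in>UNIV. ?e i) \<le> 0"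
    using lasso_expansion[of A b \<mu> x xbar p] assms by (simp add: stationary)
  moreover have "0 \<le> (\<Sum>i\<in>UNIV. ?e i)"
    by (rule sum_nonneg) (rule nonneg)
  moreover have "0 \<le> (norm (A *v (x - xbar)))\<^sup>2"
    by simp
  ultimately have "(norm (A *v (x - xbar)))\<^sup>2 = 0" and sum: "(\<Sum>i\<in>UNIV. ?e i) = 0"
    by linarith+
  then have ker: "A *v (x - xbar) = 0"
    by simp
  have e0: "?e i = 0" for i
    using sum nonneg sum_nonneg_eq_0_iff[of UNIV ?e] by simp
  have "\<bar>p $ i\<bar> = \<mu>" if "(x - xbar) $ i \<noteq> 0" for i
  proof (rule ccontr)
    assume inactive: "\<bar>p $ i\<bar> \<noteq> \<mu>"
    then have xbar0: "xbar $ i = 0"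
      using l1_subgrad_active[OF p_mem] by blast
    have "\<mu> * \<bar>x $ i\<bar> = p $ i * x $ i"
      using e0[of i] xbar0 by simp
    also have "\<dots> \<le> \<bar>p $ i\<bar> * \<bar>x $ i\<bar>"
      by (metis abs_ge_self abs_mult)
    finally have "(\<mu> - \<bar>p $ i\<bar>) * \<bar>x $ i\<bar> \<le> 0"
      by (simp add: algebra_simps)
    moreover have "\<mu> - \<bar>p $ i\<bar> > 0"
      using inactive p_mem by (auto simp: l1_subgrad_def less_le)
    ultimately show False
      using that xbar0 by (simp add: mult_le_0_iff)
  qed
  then have "x - xbar = 0"
    using inj_active[OF _ ker] by blast
  then show ?thesis by simp
qed

text \<open>The objective exceeds its minimum by some \<open>m > 0\<close> on the sphere of radius \<open>\<eta>\<close>, so for small tilts the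
  minimizers over the ball lie in its interior and satisfy the subgradient condition. Near \<open>xbar\<close> they
  vanish in the inactive coordinates; differences of minimizers are thus supported in the active set, on
  which \<open>A\<close> is bounded below by \<open>e\<close>, and monotonicity gives the Lipschitz constant \<open>1 / e\<^sup>2\<close>.\<close>

lemma tilt_stable: "tilt_stable_local_minimizer (lasso A b \<mu>) xbar"
proof -
  let ?f = "lasso_real A b \<mu>"
  obtain P Q where P: "eventually P (nhds xbar)" and Q: "eventually Q (nhds (0 :: real ^ 'n))"
    and PQ: "\<And>x v i. P x \<Longrightarrow> Q v \<Longrightarrow> \<bar>(v - lasso_grad A b x) $ i\<bar> = \<mu> \<Longrightarrow> \<bar>p $ i\<bar> = \<mu>"
    using residual_near unfolding nhds_prod eventually_prod_filter by (metis fst_conv snd_conv)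
  obtain d1 where d1: "d1 > 0" "\<And>x. dist x xbar < d1 \<Longrightarrow> P x"
    using P unfolding eventually_nhds_metric by blast
  obtain d2 where d2: "d2 > 0" "\<And>v. dist v 0 < d2 \<Longrightarrow> Q v"
    using Q unfolding eventually_nhds_metric by blast
  define \<eta> where "\<eta> = d1 / 2"
  have \<eta>: "\<eta> > 0" "\<And>x. x \<in> cball xbar \<eta> \<Longrightarrow> P x"
    using d1 by (auto simp: \<eta>_def dist_commute)
  have cont: "continuous_on S (\<lambda>x. ?f x - v \<bullet> x)" for S v
    using mu_pos by (intro continuous_intros continuous_lasso_real) simp
  have "\<exists>z\<in>sphere xbar \<eta>. \<forall>x\<in>sphere xbar \<eta>. ?f z - 0 \<bullet> z \<le> ?f x - 0 \<bullet> x"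
    by (rule continuous_attains_inf[OF _ _ cont]) (use \<eta>(1) in auto)
  then obtain z where z: "z \<in> sphere xbar \<eta>" "\<And>x. x \<in> sphere xbar \<eta> \<Longrightarrow> ?f z \<le> ?f x"
    by auto
  define m where "m = ?f z - ?f xbar"
  have "m > 0"
    using minimizer_unique[of z] z(1) \<eta>(1) by (force simp: m_def not_le[symmetric])
  have "\<exists>e>0. \<forall>\<xi>\<in>{\<xi>. \<forall>i. \<xi> $ i \<noteq> 0 \<longrightarrow> \<bar>p $ i\<bar> = \<mu>}. norm (A *v \<xi>) \<ge> e * norm \<xi>"
  proof (rule injective_imp_isometric)
    show subspace: "subspace {\<xi> :: real ^ 'n. \<forall>i. \<xi> $ i \<noteq> 0 \<longrightarrow> \<bar>p $ i\<bar> = \<mu>}"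
      by (auto simp: subspace_def) (metis add.right_neutral)
    then show "closed {\<xi> :: real ^ 'n. \<forall>i. \<xi> $ i \<noteq> 0 \<longrightarrow> \<bar>p $ i\<bar> = \<mu>}"
      by (rule closed_subspace)
  qed (use inj_active in \<open>auto intro: matrix_vector_mul_bounded_linear\<close>)
  then obtain e where e: "e > 0"
    "\<And>\<xi>. (\<And>i. \<xi> $ i \<noteq> 0 \<Longrightarrow> \<bar>p $ i\<bar> = \<mu>) \<Longrightarrow> e * norm \<xi> \<le> norm (A *v \<xi>)"
    by auto
  define V where "V = ball (0 :: real ^ 'n) (min d2 (m / \<eta>))"
  define M where "M v = argmin_set (\<lambda>x. lasso A b \<mu> x - ereal (v \<bullet> x)) (cball xbar \<eta>)" for v
  have M_iff: "x \<in> M v \<longleftrightarrow> x \<in> cball xbar \<eta> \<and>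
      (\<forall>x'\<in>cball xbar \<eta>. ?f x - v \<bullet> x \<le> ?f x' - v \<bullet> x')" for x v
    by (auto simp: M_def argmin_set_def is_arg_min_def lasso_eq_lasso_real not_less)
  have M_ex: "\<exists>x. x \<in> M v" for v
  proof -
    have "\<exists>x\<in>cball xbar \<eta>. \<forall>x'\<in>cball xbar \<eta>. ?f x - v \<bullet> x \<le> ?f x' - v \<bullet> x'"
      by (rule continuous_attains_inf[OF _ _ cont]) (use \<eta>(1) in auto)
    then show ?thesis
      by (auto simp: M_iff)
  qed
  have residual: "v - lasso_grad A b x \<in> l1_subgrad \<mu> x" if v: "v \<in> V" and x: "x \<in> M v" for v x
  proof -
    have x_le: "x \<in> cball xbar \<eta>" "\<And>x'. x' \<in> cball xbar \<eta> \<Longrightarrow> ?f x - v \<bullet> x \<le> ?f x' - v \<bullet> x'"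
      using x by (auto simp: M_iff)
    have "x \<notin> sphere xbar \<eta>"
    proof
      assume sphere: "x \<in> sphere xbar \<eta>"
      then have "m \<le> ?f x - ?f xbar"
        using z(2) by (simp add: m_def)
      also have "\<dots> \<le> v \<bullet> (x - xbar)"
        using x_le(2)[of xbar] \<eta>(1) by (simp add: inner_diff_right)
      also have "\<dots> \<le> norm v * norm (x - xbar)"
        by (rule norm_cauchy_schwarz)
      also have "\<dots> = norm v * \<eta>"
        using sphere by (simp add: dist_norm norm_minus_commute)
      also have "\<dots> < m"
        using v \<eta>(1) by (simp add: V_def pos_less_divide_eq)
      finally show False by simp
    qed
    then have interior: "dist x xbar < \<eta>"
      using x_le(1) by (auto simp: dist_commute)
    have "convex_on UNIV (\<lambda>x. - v \<bullet> x)"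
      by (rule convex_onI) (simp_all add: inner_add_right)
    then have "convex_on UNIV (\<lambda>x. ?f x + - v \<bullet> x)"
      using mu_pos by (intro convex_on_add convex_lasso_real) simp_all
    then have convex: "convex_on UNIV (\<lambda>x. ?f x - v \<bullet> x)"
      by simp
    have minimal: "\<forall>x'\<in>ball x (\<eta> - dist x xbar). ?f x - v \<bullet> x \<le> ?f x' - v \<bullet> x'"
    proof
      fix x' assume "x' \<in> ball x (\<eta> - dist x xbar)"
      then have "x' \<in> cball xbar \<eta>"
        using dist_triangle[of xbar x' x] by (simp add: dist_commute)
      then show "?f x - v \<bullet> x \<le> ?f x' - v \<bullet> x'"
        by (rule x_le(2))
    qed
    have "\<forall>x'\<in>UNIV. ?f x - v \<bullet> x \<le> ?f x' - v \<bullet> x'"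
      by (rule convex_local_global_minimum[OF _ convex _ minimal]) (use interior in simp_all)
    then have "\<forall>x'. ?f x + v \<bullet> (x' - x) \<le> ?f x'"
      by (simp add: inner_diff_right algebra_simps)
    then show ?thesis
      using lasso_subgradient_iff mu_pos by (metis less_imp_le)
  qed
  have lip: "norm (x' - x) \<le> 1 / e\<^sup>2 * norm (v' - v)"
    if v: "v \<in> V" "x \<in> M v" and v': "v' \<in> V" "x' \<in> M v'" for v x v' x'
  proof -
    note r = residual[OF v] residual[OF v']
    have active: "\<bar>p $ i\<bar> = \<mu>" if "(x' - x) $ i \<noteq> 0" for i
    proof -
      have near: "P x" "P x'" "Q v" "Q v'"
        using v v' \<eta>(2) d2(2) by (auto simp: M_iff V_def dist_commute)
      from that have "x $ i \<noteq> 0 \<or> x' $ i \<noteq> 0" by auto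
      then show ?thesis
        using l1_subgrad_active[OF r(1)] l1_subgrad_active[OF r(2)] PQ near by blast
    qed
    have "?f x + v \<bullet> (x' - x) + 1 / 2 * (norm (A *v (x' - x)))\<^sup>2 \<le> ?f x'"
      "?f x' + v' \<bullet> (x - x') + 1 / 2 * (norm (A *v (x - x')))\<^sup>2 \<le> ?f x"
      by (rule lasso_strong_subgradient[OF r(1)], rule lasso_strong_subgradient[OF r(2)])
    moreover have "norm (A *v (x - x')) = norm (A *v (x' - x))"
      by (simp add: matrix_vector_mult_diff_distrib norm_minus_commute)
    ultimately have "(norm (A *v (x' - x)))\<^sup>2 \<le> (v' - v) \<bullet> (x' - x)"
      by (simp add: inner_diff_left inner_diff_right)
    also have "\<dots> \<le> norm (v' - v) * norm (x' - x)"
      by (rule norm_cauchy_schwarz)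
    finally have upper: "(norm (A *v (x' - x)))\<^sup>2 \<le> norm (v' - v) * norm (x' - x)" .
    have "e * norm (x' - x) \<le> norm (A *v (x' - x))"
      by (rule e(2)) (rule active)
    then have "(e * norm (x' - x))\<^sup>2 \<le> (norm (A *v (x' - x)))\<^sup>2"
      using e(1) by (intro power_mono) simp_all
    with upper have "(e * norm (x' - x))\<^sup>2 \<le> norm (v' - v) * norm (x' - x)"
      by linarith
    then have "norm (x' - x) * (e\<^sup>2 * norm (x' - x)) \<le> norm (x' - x) * norm (v' - v)"
      by (simp add: power_mult_distrib power2_eq_square ac_simps)
    then have "e\<^sup>2 * norm (x' - x) \<le> norm (v' - v)"
      by (cases "x' = x") auto
    then show ?thesis
      using e(1) by (simp add: pos_le_divide_eq mult.commute)
  qed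
  define h where "h v = (SOME x. x \<in> M v)" for v
  have h: "h v \<in> M v" for v
    unfolding h_def using M_ex by (rule someI_ex)
  have M_single: "M v = {h v}" if "v \<in> V" for v
    using lip[OF that h that] h by auto
  have "0 \<in> V"
    using d2(1) \<open>m > 0\<close> \<eta>(1) by (simp add: V_def)
  moreover have "xbar \<in> M 0"
    using lasso_subgradient[of 0 A b xbar \<mu>] p_mem \<eta>(1) by (simp add: M_iff stationary)
  ultimately have "h 0 = xbar"
    using M_single[of 0] by simp
  moreover have "(1 / e\<^sup>2)-lipschitz_on V h"
    using lip[OF _ h _ h] e(1) by (intro lipschitz_onI) (auto simp: dist_norm)
  moreover have "open V"
    by (simp add: V_def)
  moreover have "\<bar>lasso A b \<mu> xbar\<bar> \<noteq> \<infinity>"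
    by (simp add: lasso_eq_lasso_real)
  ultimately show ?thesis
    unfolding tilt_stable_local_minimizer_def
    using \<open>0 \<in> V\<close> \<eta>(1) M_single[unfolded M_def] by blast
qed


section \<open>Second-order solvability and semismoothness\<close>

text \<open>A solution \<open>d\<close> supported in the support of \<open>x\<close> suffices; there the condition on normals reads
  \<open>A\<^sup>TAd = - v\<close>.\<close>

lemma subdiff2_lasso_solvable:
  "\<exists>U V. open U \<and> xbar \<in> U \<and> open V \<and> 0 \<in> V \<and>
    (\<forall>(x, v) \<in> gph (subdiff (lasso A b \<mu>)) \<inter> U \<times> V. \<exists>d. - v \<in> subdiff2 (lasso A b \<mu>) x v d)"
proof -
  obtain P Q where P: "eventually P (nhds xbar)" and Q: "eventually Q (nhds (0 :: real ^ 'n))"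
    and PQ: "\<And>x v i. P x \<Longrightarrow> Q v \<Longrightarrow> \<bar>(v - lasso_grad A b x) $ i\<bar> = \<mu> \<Longrightarrow> \<bar>p $ i\<bar> = \<mu>"
    using residual_near unfolding nhds_prod eventually_prod_filter by (metis fst_conv snd_conv)
  obtain U where U: "open U" "xbar \<in> U" "\<And>x. x \<in> U \<Longrightarrow> P x"
    using P unfolding eventually_nhds by blast
  obtain V where V: "open V" "0 \<in> V" "\<And>v. v \<in> V \<Longrightarrow> Q v"
    using Q unfolding eventually_nhds by blast
  have solvable: "\<exists>d. - v \<in> subdiff2 (lasso A b \<mu>) x v d"
    if graph: "(x, v) \<in> gph (subdiff (lasso A b \<mu>))" and "x \<in> U" "v \<in> V" for x v
  proof -
    have y: "v - lasso_grad A b x \<in> l1_subgrad \<mu> x"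
      using graph mu_pos by (simp add: mem_gph_subdiff_lasso)
    have "\<bar>p $ i\<bar> = \<mu>" if "x $ i \<noteq> 0" for i
      using l1_subgrad_active[OF y that] PQ U(3)[OF \<open>x \<in> U\<close>] V(3)[OF \<open>v \<in> V\<close>] by blast
    then obtain d where "\<And>i. x $ i = 0 \<Longrightarrow> d $ i = 0"
      "\<And>i. x $ i \<noteq> 0 \<Longrightarrow> (transpose A *v (A *v d)) $ i = (- v) $ i"
      using solvable_on_active[of "{i. x $ i \<noteq> 0}" "- v"] by auto
    then have "(- v, - d) \<in> limiting_normal_cone (gph (subdiff (lasso A b \<mu>))) (x, v)"
      by (intro limiting_normal_lassoI[OF mu_pos y]) (simp_all add: matrix_vector_mult_minus)
    then show ?thesis
      by (auto simp: subdiff2_def coderivative_def)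
  qed
  show ?thesis
    using U(1,2) V(1,2) solvable by (intro exI[of _ U] exI[of _ V]) auto
qed

text \<open>With \<open>x\<^sub>k = xbar + t\<^sub>k u\<^sub>k\<close> and \<open>y\<^sub>k = p + t\<^sub>k e\<^sub>k\<close> one has, eventually and in each coordinate, a zero factor
  in both products \<open>z\<^sub>k u\<^sub>k\<close> and \<open>c\<^sub>k e\<^sub>k\<close>: a coordinate of \<open>x\<^sub>k\<close> that is nonzero forces \<open>z\<^sub>k = 0\<close> and one
  that is zero has not moved; a coordinate of \<open>y\<^sub>k\<close> that is active has not moved and an inactive
  one forces \<open>c\<^sub>k = 0\<close>. The shear does not affect the sum of the products, by symmetry of \<open>A\<^sup>TA\<close>.\<close>

lemma semismooth_star: "semismooth_star_at (subdiff (lasso A b \<mu>)) (xbar, 0)"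
proof -
  let ?G = "gph (subdiff (lasso A b \<mu>))"
  have "us \<bullet> u = vs \<bullet> v" if dir: "(us, - vs) \<in> dir_normal_cone ?G (xbar, 0) (u, v)" for u v us vs
  proof -
    obtain ts ds ns where ts: "\<And>k. ts k > 0" "ts \<longlonglongrightarrow> 0"
      and lim: "ds \<longlonglongrightarrow> (u, v)" "ns \<longlonglongrightarrow> (us, - vs)"
      and normal: "\<And>k. ns k \<in> regular_normal_cone ?G ((xbar, 0) + ts k *\<^sub>R ds k)"
      using dir unfolding dir_normal_cone_def by blast
    define du dv as cs where "du k = fst (ds k)" and "dv k = snd (ds k)"
      and "as k = fst (ns k)" and "cs k = snd (ns k)" for k
    have lims: "du \<longlonglongrightarrow> u" "dv \<longlonglongrightarrow> v" "as \<longlonglongrightarrow> us" "cs \<longlonglongrightarrow> - vs"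
      using tendsto_fst[OF lim(1)] tendsto_snd[OF lim(1)] tendsto_fst[OF lim(2)] tendsto_snd[OF lim(2)]
      by (simp_all add: du_def[abs_def] dv_def[abs_def] as_def[abs_def] cs_def[abs_def])
    define xs ys zs where "xs k = xbar + ts k *\<^sub>R du k"
      and "ys k = ts k *\<^sub>R dv k - lasso_grad A b (xs k)"
      and "zs k = as k + transpose A *v (A *v cs k)" for k
    define es where "es k = dv k - transpose A *v (A *v du k)" for k
    have ys_eq: "ys k = p + ts k *\<^sub>R es k" for k
    proof -
      have "lasso_grad A b (xs k) = lasso_grad A b xbar + transpose A *v (A *v (xs k - xbar))"
        unfolding lasso_grad_diff[symmetric, of A "xs k" xbar b] by simp
      then show ?thesis
        by (simp add: ys_def es_def xs_def stationary matrix_vector_mult_scaleR scaleR_diff_right)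
    qed
    have normal': "(as k, cs k) \<in> regular_normal_cone ?G (xs k, ts k *\<^sub>R dv k)" for k
    proof -
      have "(xbar, 0) + ts k *\<^sub>R ds k = (xs k, ts k *\<^sub>R dv k)"
        by (simp add: prod_eq_iff xs_def du_def dv_def)
      with normal[of k] show ?thesis by (simp add: as_def cs_def)
    qed
    have pair: "l1_normal_pair \<mu> (xs k) (ys k) (zs k) (cs k)" for k
      using regular_normal_lasso[OF mu_pos normal'] by (simp add: ys_def zs_def)
    have mem: "ys k \<in> l1_subgrad \<mu> (xs k)" for k
      using normal'[of k] mu_pos by (simp add: regular_normal_cone_def mem_gph_subdiff_lasso ys_def)
    have "(\<lambda>k. xbar + ts k *\<^sub>R du k) \<longlonglongrightarrow> xbar + 0 *\<^sub>R u"
      by (intro tendsto_intros lims ts)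
    then have xs_lim: "xs \<longlonglongrightarrow> xbar"
      by (simp add: xs_def[abs_def])
    have "(\<lambda>k. ts k *\<^sub>R dv k - lasso_grad A b (xs k)) \<longlonglongrightarrow> 0 *\<^sub>R v - lasso_grad A b xbar"
      by (intro tendsto_intros lims ts xs_lim)
    then have ys_lim: "ys \<longlonglongrightarrow> p"
      by (simp add: ys_def[abs_def] stationary)
    have "\<forall>\<^sub>F k in sequentially. zs k \<bullet> du k + cs k \<bullet> es k = 0"
      using eventually_compose_filterlim[OF support_near xs_lim]
        eventually_compose_filterlim[OF active_near ys_lim]
    proof eventually_elim
      case (elim k)
      have "zs k $ i * du k $ i + cs k $ i * es k $ i = 0" for i
      proof -
        have "es k $ i = 0" if "\<bar>ys k $ i\<bar> = \<mu>"
          using elim(2) that ts(1)[of k] by (auto simp: ys_eq)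
        moreover have "cs k $ i = 0" if "\<bar>ys k $ i\<bar> \<noteq> \<mu>"
          using that mem[of k] pair[of k] by (auto simp: l1_normal_pair_def l1_subgrad_def less_le)
        moreover have "du k $ i = 0" if "xs k $ i = 0"
          using elim(1) that ts(1)[of k] by (auto simp: xs_def)
        moreover have "zs k $ i = 0" if "xs k $ i \<noteq> 0"
          using that pair[of k] by (simp add: l1_normal_pair_def)
        ultimately show ?thesis
          by (metis add.right_neutral mult_zero_left mult_zero_right)
      qed
      then show ?case
        by (simp add: inner_vec_def sum.distrib[symmetric])
    qed
    moreover have "zs k \<bullet> du k + cs k \<bullet> es k = as k \<bullet> du k + cs k \<bullet> dv k" for k
    proof -
      have "cs k \<bullet> (transpose A *v (A *v du k)) = (transpose A *v (A *v cs k)) \<bullet> du k"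
        by (metis inner_commute inner_transpose_mult)
      then show ?thesis
        by (simp add: zs_def es_def inner_add_left inner_diff_right)
    qed
    ultimately have "\<forall>\<^sub>F k in sequentially. as k \<bullet> du k + cs k \<bullet> dv k = 0"
      by simp
    then have "(\<lambda>k. as k \<bullet> du k + cs k \<bullet> dv k) \<longlonglongrightarrow> 0"
      by (rule tendsto_eventually)
    moreover have "(\<lambda>k. as k \<bullet> du k + cs k \<bullet> dv k) \<longlonglongrightarrow> us \<bullet> u + - vs \<bullet> v"
      by (intro tendsto_intros lims)
    ultimately have "us \<bullet> u + - vs \<bullet> v = 0"
      using LIMSEQ_unique by blast
    then show ?thesis by simp
  qed
  moreover have "(xbar, 0) \<in> ?G"
    using p_mem mu_pos by (simp add: mem_gph_subdiff_lasso stationary)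
  ultimately show ?thesis
    by (auto simp: semismooth_star_at_def gph_def[of "dir_coderivative _ _ _"] dir_coderivative_def)
qed


section \<open>The semismooth Newton step\<close>

text \<open>Let \<open>v\<close> be the proximal point, \<open>y\<close> its subgradient and \<open>\<xi> = x + d - xbar\<close> the error after the
  step. Since \<open>(x - v) / \<gamma> = q(x) + y\<close>, the inclusion defining \<open>d\<close> states that
  \<open>(p - y - A\<^sup>TA\<xi>, v - xbar - \<xi>)\<close> is a normal at \<open>(v, y)\<close>. If \<open>y\<^sub>i\<close> is inactive, then \<open>v\<^sub>i = xbar\<^sub>i = 0\<close> and
  the second component forces \<open>\<xi>\<^sub>i = 0\<close>. If it is active, then \<open>y\<^sub>i = p\<^sub>i\<close>, and either \<open>v\<^sub>i \<noteq> 0\<close> and the first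
  component gives \<open>(A\<^sup>TA\<xi>)\<^sub>i = 0\<close>, or \<open>v\<^sub>i = xbar\<^sub>i = 0\<close> and the sign condition gives
  \<open>(A\<^sup>TA\<xi>)\<^sub>i \<xi>\<^sub>i \<le> 0\<close>. Summation yields \<open>\<parallel>A\<xi>\<parallel>\<^sup>2 \<le> 0\<close>.\<close>

lemma newton_step_exact:
  assumes \<gamma>: "\<gamma> > 0"
  shows "\<forall>\<^sub>F x in nhds xbar. (\<exists>d. newton_direction A b \<mu> \<gamma> x d) \<and>
    (\<forall>d. newton_direction A b \<mu> \<gamma> x d \<longrightarrow> x + d = xbar)"
proof -
  define u where "u x = x - \<gamma> *\<^sub>R lasso_grad A b x" for x
  define v where "v x = soft_threshold (\<gamma> * \<mu>) (u x)" for x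
  define y where "y x = (1 / \<gamma>) *\<^sub>R (u x - v x)" for x
  have y_mem: "y x \<in> l1_subgrad \<mu> (v x)" for x
    unfolding y_def v_def by (rule soft_threshold_residual[OF mu_pos \<gamma>])
  have u_bar: "u xbar = xbar + \<gamma> *\<^sub>R p"
    by (simp add: u_def stationary)
  have v_bar: "v xbar = xbar"
    unfolding v_def by (rule soft_threshold_eqI[OF mu_pos \<gamma>]) (use \<gamma> p_mem in \<open>simp add: u_bar\<close>)
  have y_bar: "y xbar = p"
    using \<gamma> by (simp add: y_def v_bar u_bar)
  have v_lim: "(v \<longlongrightarrow> v xbar) (nhds xbar)" and y_lim: "(y \<longlongrightarrow> y xbar) (nhds xbar)"
    unfolding y_def[abs_def] v_def[abs_def] u_def[abs_def]
    by (intro tendsto_intros filterlim_ident)+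
  have "\<forall>\<^sub>F x in nhds xbar. \<forall>i. v x $ i = 0 \<longrightarrow> xbar $ i = 0"
    using eventually_compose_filterlim[OF support_near] v_lim by (simp add: v_bar)
  moreover have "\<forall>\<^sub>F x in nhds xbar. \<forall>i. \<bar>y x $ i\<bar> = \<mu> \<longrightarrow> y x $ i = p $ i"
    using eventually_compose_filterlim[OF active_near] y_lim by (simp add: y_bar)
  ultimately show ?thesis
  proof eventually_elim
    case (elim x)
    define a where "a d = - ((1 / \<gamma>) *\<^sub>R (x - v x)) - (transpose A ** A) *v d" for d
    have direction_iff: "newton_direction A b \<mu> \<gamma> x d \<longleftrightarrow>
        (a d, - (x - v x + d)) \<in> limiting_normal_cone (gph (subdiff (lasso_reg \<mu>))) (v x, y x)" for d
      using prox_lasso_reg[OF mu_pos \<gamma>, of "u x" "v x"] y_mem[of x]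
      by (auto simp: newton_direction_def lasso_grad_alt[symmetric] u_def[symmetric]
          y_def[symmetric] subdiff2_def coderivative_def a_def)
    have active: "\<bar>p $ i\<bar> = \<mu>" if "v x $ i \<noteq> 0" for i
      using l1_subgrad_active[OF y_mem that] elim(2) by metis
    obtain w where w: "\<And>i. v x $ i = 0 \<Longrightarrow> w $ i = 0"
      "\<And>i. v x $ i \<noteq> 0 \<Longrightarrow> (transpose A *v (A *v w)) $ i
        = (transpose A *v (A *v (x - v x)) - (1 / \<gamma>) *\<^sub>R (x - v x)) $ i"
      using solvable_on_active[of "{i. v x $ i \<noteq> 0}"
          "transpose A *v (A *v (x - v x)) - (1 / \<gamma>) *\<^sub>R (x - v x)"] active by auto
    have "newton_direction A b \<mu> \<gamma> x (w - (x - v x))"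
      unfolding direction_iff
    proof (rule limiting_normal_lasso_regI[OF mu_pos y_mem])
      fix i
      show "a (w - (x - v x)) $ i = 0" if "v x $ i \<noteq> 0"
        using w(2)[OF that]
        by (simp add: a_def matrix_vector_mul_assoc[symmetric] matrix_vector_mult_diff_distrib)
      show "(- (x - v x + (w - (x - v x)))) $ i = 0" if "v x $ i = 0"
        using w(1)[OF that] by simp
    qed
    moreover have "x + d = xbar" if d: "newton_direction A b \<mu> \<gamma> x d" for d
    proof -
      define \<xi> where "\<xi> = x + d - xbar"
      have "(1 / \<gamma>) *\<^sub>R (x - v x) = lasso_grad A b x + y x"
        using \<gamma> by (simp add: y_def u_def algebra_simps)
      moreover have "lasso_grad A b x + (transpose A ** A) *v d = lasso_grad A b (x + d)"
        using lasso_grad_diff[of A b "x + d" x] by (simp add: matrix_vector_mul_assoc[symmetric] algebra_simps)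
      moreover have "lasso_grad A b (x + d) = transpose A *v (A *v \<xi>) - p"
        unfolding \<xi>_def lasso_grad_diff[symmetric, of A "x + d" xbar b] by (simp add: stationary)
      ultimately have a: "a d = p - y x - transpose A *v (A *v \<xi>)"
        unfolding a_def by (simp add: algebra_simps)
      have c: "- (x - v x + d) = v x - xbar - \<xi>"
        by (simp add: \<xi>_def)
      have pair: "l1_normal_pair \<mu> (v x) (y x) (p - y x - transpose A *v (A *v \<xi>)) (v x - xbar - \<xi>)"
        using limiting_normal_lasso_reg[OF mu_pos d[unfolded direction_iff]] unfolding a c .
      have coord: "(\<bar>p $ i\<bar> = \<mu> \<or> \<xi> $ i = 0) \<and> (transpose A *v (A *v \<xi>)) $ i * \<xi> $ i \<le> 0" for i
      proof (cases "\<bar>y x $ i\<bar> = \<mu>")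
        case False
        then have "v x $ i = 0" "\<bar>y x $ i\<bar> < \<mu>"
          using l1_subgrad_active[OF y_mem] y_mem[of x] by (auto simp: l1_subgrad_def less_le)
        then have "\<xi> $ i = 0"
          using pair elim(1) by (auto simp: l1_normal_pair_def)
        then show ?thesis by simp
      next
        case True
        then have yp: "y x $ i = p $ i" "\<bar>p $ i\<bar> = \<mu>"
          using elim(2) by (metis, metis)
        have "(transpose A *v (A *v \<xi>)) $ i * \<xi> $ i \<le> 0"
        proof (cases "v x $ i = 0")
          case True
          then have "(- (transpose A *v (A *v \<xi>)) $ i) * (- \<xi> $ i) \<le> 0"
            using pair yp(1) elim(1) by (auto simp: l1_normal_pair_def dest!: spec[of _ i])
          then show ?thesis by simp
        next
          case False
          then show ?thesis
            using pair yp(1) by (auto simp: l1_normal_pair_def dest!: spec[of _ i])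
        qed
        with yp show ?thesis by simp
      qed
      have "(transpose A *v (A *v \<xi>)) \<bullet> \<xi> \<le> 0"
        using coord by (simp add: inner_vec_def sum_nonpos)
      then have "A *v \<xi> = 0"
        unfolding inner_transpose_mult by (metis inner_eq_zero_iff inner_ge_zero order_antisym)
      then have "\<xi> = 0"
        using coord by (intro inj_active) auto
      then show ?thesis
        by (simp add: \<xi>_def)
    qed
    ultimately show ?case
      by blast
  qed
qed

lemma terminal_iff: "terminal A b \<mu> x \<longleftrightarrow> x = xbar"
proof
  assume "terminal A b \<mu> x"
  then have "- lasso_grad A b x \<in> l1_subgrad \<mu> x"
    using mu_pos by (simp add: terminal_def subdiff_lasso)
  then have "lasso_real A b \<mu> x \<le> lasso_real A b \<mu> xbar"
    using lasso_subgradient[of 0 A b x \<mu> xbar] by simp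
  then show "x = xbar"
    by (rule minimizer_unique)
next
  assume "x = xbar"
  then show "terminal A b \<mu> x"
    using p_mem mu_pos by (simp add: terminal_def subdiff_lasso stationary)
qed

text \<open>A run is at \<open>xbar\<close> after at most one step and stops there; the condition on infinite runs is
  therefore void.\<close>

lemma newton_converges:
  assumes "\<gamma> > 0"
  shows "\<exists>U. open U \<and> xbar \<in> U \<and> (\<forall>x0\<in>U. well_defined_from A b \<mu> \<gamma> x0 \<and>
    superlinearly_convergent_from A b \<mu> \<gamma> xbar x0)"
proof -
  obtain U where U: "open U" "xbar \<in> U"
    and ex: "\<And>x. x \<in> U \<Longrightarrow> \<exists>d. newton_direction A b \<mu> \<gamma> x d"
    and exact: "\<And>x d. x \<in> U \<Longrightarrow> newton_direction A b \<mu> \<gamma> x d \<Longrightarrow> x + d = xbar"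
    using newton_step_exact[OF assms] unfolding eventually_nhds by blast
  have step: "x' = xbar" if "x \<in> U" "newton_step A b \<mu> \<gamma> x x'" for x x'
    using that exact by (auto simp: newton_step_def)
  have stop: "\<not> newton_step A b \<mu> \<gamma> xbar x'" for x'
    by (simp add: newton_step_def terminal_iff)
  have reach: "x = x0 \<or> x = xbar" if "x0 \<in> U" "(newton_step A b \<mu> \<gamma>)\<^sup>*\<^sup>* x0 x" for x0 x
    using that(2,1) by (induction rule: rtranclp_induct) (use step stop in auto)
  have "well_defined_from A b \<mu> \<gamma> x0" if "x0 \<in> U" for x0
    using reach[OF that] ex[OF that] by (auto simp: well_defined_from_def terminal_iff)
  moreover have "superlinearly_convergent_from A b \<mu> \<gamma> xbar x0" if "x0 \<in> U" for x0
  proof -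
    have False if run: "xs 0 = x0" "\<And>k. newton_step A b \<mu> \<gamma> (xs k) (xs (Suc k))" for xs
    proof -
      have "xs (Suc 0) = xbar"
        using step[of x0 "xs (Suc 0)"] run(1) run(2)[of 0] \<open>x0 \<in> U\<close> by simp
      then show False
        using run(2)[of "Suc 0"] stop by simp
    qed
    then show ?thesis
      by (auto simp: superlinearly_convergent_from_def terminal_iff)
  qed
  ultimately show ?thesis
    using U by blast
qed

end


section \<open>The Lasso theorem\<close>

lemma prox_bounded_lasso_reg:
  assumes "\<mu> \<ge> 0"
  shows "prox_bounded (lasso_reg \<mu> :: real ^ 'n \<Rightarrow> ereal)"
proof -
  have "\<forall>x :: real ^ 'n. lasso_reg \<mu> x \<ge> ereal (x \<bullet> 0 / 2 + 0 \<bullet> x + 0)"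
    using assms by (simp add: lasso_reg_def l1_norm_def sum_nonneg)
  then show ?thesis
    unfolding prox_bounded_def by (intro exI[of _ "\<lambda>_. 0"] exI[of _ 0]) (simp add: linear_zero)
qed

lemma continuously_prox_regular_lasso_reg:
  fixes xbar :: "real ^ 'n"
  assumes \<mu>: "\<mu> \<ge> 0" and p: "p \<in> l1_subgrad \<mu> xbar"
  shows "continuously_prox_regular (lasso_reg \<mu>) xbar p"
proof -
  have cont: "isCont (lasso_reg \<mu>) x" for x :: "real ^ 'n"
    unfolding isCont_def lasso_reg_def[abs_def] l1_norm_def by (intro tendsto_intros)
  have sub: "lasso_reg \<mu> u + ereal (v \<bullet> (x - u)) \<le> lasso_reg \<mu> x"
    if "v \<in> l1_subgrad \<mu> u" for x u v :: "real ^ 'n"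
    using lasso_subgradient[of v "0 :: real ^ 'n ^ 'n" 0 u \<mu> x] that
    by (simp add: lasso_reg_def lasso_real_def lasso_grad_def)
  have "lasso_reg \<mu> x \<ge> lasso_reg \<mu> u + ereal (v \<bullet> (x - u) - 1 / 2 * (norm (x - u))\<^sup>2)"
    if "v \<in> l1_subgrad \<mu> u" for x u v :: "real ^ 'n"
    by (rule order_trans[OF add_left_mono sub[OF that]]) simp
  moreover have "lsc_around (lasso_reg \<mu>) xbar"
  proof -
    have "lasso_reg \<mu> u \<le> Liminf (at u) (lasso_reg \<mu>)" for u :: "real ^ 'n"
      using lim_imp_Liminf[OF _ cont[of u, unfolded isCont_def]] by simp
    then show ?thesis
      unfolding lsc_around_def by (intro exI[of _ 1]) simp
  qed
  ultimately have "prox_regular (lasso_reg \<mu>) xbar p"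
    using p unfolding prox_regular_def subdiff_lasso_reg[OF \<mu>]
    by (intro conjI exI[of _ 1]) (auto simp: lasso_reg_def)
  moreover have "subdiff_continuous (lasso_reg \<mu>) xbar p"
    using p isCont_tendsto_compose[OF cont]
    by (auto simp: subdiff_continuous_def subdiff_lasso_reg[OF \<mu>])
  ultimately show ?thesis
    by (simp add: continuously_prox_regular_def)
qed

theorem theorem8p2:
  fixes A :: "real ^ 'n ^ 'm" and b :: "real ^ 'm" and \<mu> :: real and xbar :: "real ^ 'n"
  assumes "\<mu> > 0"
    and "xbar \<in> argmin_set (lasso A b \<mu>) UNIV"
    and "metrically_regular_around (subdiff (lasso A b \<mu>)) (xbar, 0)"
  shows
    "(prox_bounded (lasso_reg \<mu> :: real ^ 'n \<Rightarrow> ereal) \<and>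
      continuously_prox_regular (lasso_reg \<mu>) xbar
        (- ((transpose A ** A) *v xbar) + transpose A *v b) \<and>
      (\<exists>U V. open U \<and> xbar \<in> U \<and> open V \<and> 0 \<in> V \<and>
        (\<forall>(x, v) \<in> gph (subdiff (lasso A b \<mu>)) \<inter> U \<times> V.
          \<exists>d. - v \<in> subdiff2 (lasso A b \<mu>) x v d)) \<and>
      semismooth_star_at (subdiff (lasso A b \<mu>)) (xbar, 0)) \<and>
     (\<forall>\<gamma>>0. invertible (mat 1 - \<gamma> *\<^sub>R (transpose A ** A)) \<longrightarrow>
      (\<exists>U. open U \<and> xbar \<in> U \<and>
        (\<forall>x0\<in>U. well_defined_from A b \<mu> \<gamma> x0 \<and>
          superlinearly_convergent_from A b \<mu> \<gamma> xbar x0))) \<and>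
     tilt_stable_local_minimizer (lasso A b \<mu>) xbar"
proof -
  define p where "p = - lasso_grad A b xbar"
  interpret nondegenerate_lasso A b \<mu> xbar p
    unfolding p_def by (rule nondegenerate_if_metrically_regular[OF assms(1,3)])
  have p_alt: "- ((transpose A ** A) *v xbar) + transpose A *v b = p"
    by (simp add: p_def lasso_grad_alt)
  have "prox_bounded (lasso_reg \<mu> :: real ^ 'n \<Rightarrow> ereal)"
    using assms(1) by (intro prox_bounded_lasso_reg) simp
  moreover have "continuously_prox_regular (lasso_reg \<mu>) xbar p"
    using mu_pos p_mem by (intro continuously_prox_regular_lasso_reg) simp_all
  ultimately show ?thesis
    unfolding p_alt
    using subdiff2_lasso_solvable semismooth_star newton_converges tilt_stable by blast
qed

end
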